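(* Let $l$ be odd, $R=\mathbb F_2[x]/(x^l+1)$, $A\in R^{m_A\times n_A}$, $B\in R^{m_B\times n_B}$, with $r_A:=n_A-m_A\ge1$ and $r_B^*:=m_B-n_B\ge1$. Write $x^l+1=\prod_{i=1}^t b^{(i)}$ with $b^{(i)}$ irreducible. For each $i$ let $I_A^{(i)}\subseteq[n_A]$ and $I_{B^*}^{(i)}\subseteq[m_B]$ denote information sets of the $i$-th components $\ker A_{(i)}$ and $\ker B_{(i)}^T$. Then the lifted-product code $\mathrm{LP}_l(A,B)$ admits a canonical LP basis if and only if these information sets can be chosen such that $$\Big|\bigcap_{i=1}^t I_A^{(i)}\Big|\ \ge\ r_A\qquad\text{and}\qquad \Big|\bigcap_{i=1}^t I_{B^*}^{(i)}\Big|\ \ge\ r_B^* .$$ In that case the canonical sector contains $k_c:=r_A\,r_B^*\,l\le k$ logical qubits, where $k$ is the number of logical qubits of $\mathrm{LP}_l(A,B)$ (the remaining logical qubits being called residual).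
   Context: Conjugation: $\bar f(x)=f(x^{-1})$ on $R$, $C^*=\bar C^T$ for matrices over $R$. Components: $R_{(i)}=\mathbb F_2[x]/(b^{(i)})$ is a field; $\beta_i$ is a root of $b^{(i)}$ in it, and $C_{(i)}=C(\beta_i)$. An information set of a $k$-dimensional linear code over a field is a set of $k$ coordinates on which restriction of codewords is injective. Lifted-product code $\mathrm{LP}_l(A,B)$: with $\mathcal A_1=R^{n_A}$, $\mathcal A_0=R^{m_A}$, $\mathcal B_1=R^{n_B}$, $\mathcal B_0=R^{m_B}$, it is the CSS code obtained by binarizing $\mathcal M_2\xrightarrow{\partial_2}\mathcal M_1\xrightarrow{\partial_1}\mathcal M_0$, $\mathcal M_2=\mathcal A_1\otimes_R\mathcal B_1$, $\mathcal M_1=(\mathcal A_1\otimes_R\mathcal B_0)\oplus(\mathcal A_0\otimes_R\mathcal B_1)$, $\mathcal M_0=\mathcal A_0\otimes_R\mathcal B_0$, $\partial_1=(A\otimes I,I\otimes B)$, $\partial_2=\binom{I\otimes B}{A\otimes I}$. Supports of $Z$-type (resp. $X$-type) logical operators are classes in $H_1(\mathcal M)=\ker\partial_1/\mathrm{im}\,\partial_2$ (resp. $H^1(\mathcal M)=\ker\partial_2^*/\mathrm{im}\,\partial_1^*$); $k=\dim_{\mathbb F_2}H_1(\mathcal M)$. Canonical LP basis: $\mathrm{LP}_l(A,B)$ admits a canonical LP basis (is canonical) if, after permuting the coordinates of $\mathcal A_1$ and of $\mathcal B_0$, there are matrices $G_A^0\in R^{r_A\times m_A}$ and $G_B^{*0}\in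 R^{r_B^*\times n_B}$ and $\mathbb F_2$-bases of $Z$-type and of $X$-type logical supports (representatives of bases of $H_1(\mathcal M)$ and $H^1(\mathcal M)$) which contain, respectively, all the rows of $$\tilde L_Z=\mathrm{vstack}\{x^m (I_{r_A},G_A^0)\otimes_R(I_{r_B^*},0)\oplus0\}_{m=0}^{l-1},\qquad \tilde L_X=\mathrm{vstack}\{x^{m} (I_{r_A},0)\otimes_R(I_{r_B^*},G_B^{*0})\oplus0\}_{m=0}^{l-1}.$$ The logical qubits defined by these rows form the canonical sector. *)

theory Defs
  imports "Jordan_Normal_Form.VS_Connect" "HOL-Algebra.AbelCoset" "HOL-Library.Z2"
begin

section \<open>Quotients of \<open>\<bbbF>\<^sub>2[x]\<close>\<close>

text \<open>\<open>\<bbbF>\<^sub>2[x]/(q)\<close>; a residue class is represented by its remainder modulo \<open>q\<close>, as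
  in \<open>residue_ring\<close>. Both \<open>R = \<bbbF>\<^sub>2[x]/(x\<^sup>l+1)\<close> and its components
  \<open>R\<^sub>i = \<bbbF>\<^sub>2[x]/(b\<^sub>i)\<close> are of this form.\<close>

definition quot_ring :: "bit poly \<Rightarrow> bit poly ring" where
  "quot_ring q = \<lparr>carrier = {f. f mod q = f}, monoid.mult = \<lambda>f g. (f * g) mod q,
     one = 1 mod q, zero = 0, add = (+)\<rparr>"

definition vecs :: "bit poly \<Rightarrow> nat \<Rightarrow> bit poly vec set" where
  "vecs q n = {v \<in> carrier_vec n. \<forall>i<n. v $ i \<in> carrier (quot_ring q)}"

definition mats :: "bit poly \<Rightarrow> nat \<Rightarrow> nat \<Rightarrow> bit poly mat set" where
  "mats q m n = {M \<in> carrier_mat m n. \<forall>i<m. \<forall>j<n. M $$ (i, j) \<in> carrier (quot_ring q)}"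

definition reduce_vec :: "bit poly \<Rightarrow> bit poly vec \<Rightarrow> bit poly vec" where
  "reduce_vec q v = map_vec (\<lambda>f. f mod q) v"

text \<open>The product \<open>M v\<close> over \<open>\<bbbF>\<^sub>2[x]/(q)\<close>. Since reduction modulo \<open>q\<close> is a ring homomorphism,
  it suffices to reduce the product over \<open>\<bbbF>\<^sub>2[x]\<close>; the entries of \<open>M\<close> need not be reduced.\<close>

definition mat_app :: "bit poly \<Rightarrow> bit poly mat \<Rightarrow> bit poly vec \<Rightarrow> bit poly vec" where
  "mat_app q M v = reduce_vec q (M *\<^sub>v v)"

definition mat_ker :: "bit poly \<Rightarrow> bit poly mat \<Rightarrow> bit poly vec set" where
  "mat_ker q M = {v \<in> vecs q (dim_col M). mat_app q M v = 0\<^sub>v (dim_row M)}"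

definition mat_im :: "bit poly \<Rightarrow> bit poly mat \<Rightarrow> bit poly vec set" where
  "mat_im q M = mat_app q M ` vecs q (dim_col M)"


section \<open>Components and information sets\<close>

text \<open>The value \<open>f(\<beta>)\<close> in \<open>\<bbbF>\<^sub>2[x]/(q)\<close>, for \<open>f \<in> \<bbbF>\<^sub>2[x]\<close> and \<open>\<beta> \<in> \<bbbF>\<^sub>2[x]/(q)\<close>.\<close>

definition eval_quot :: "bit poly \<Rightarrow> bit poly \<Rightarrow> bit poly \<Rightarrow> bit poly" where
  "eval_quot q \<beta> f = pcompose f \<beta> mod q"

definition component :: "bit poly \<Rightarrow> bit poly \<Rightarrow> bit poly mat \<Rightarrow> bit poly mat" where
  "component q \<beta> C = map_mat (eval_quot q \<beta>) C"

definition free_mod :: "bit poly \<Rightarrow> nat \<Rightarrow> (bit poly, bit poly vec) module" where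
  "free_mod q n = \<lparr>carrier = vecs q n, mult = undefined, one = undefined, zero = 0\<^sub>v n, add = (+),
     smult = \<lambda>c v. reduce_vec q (c \<cdot>\<^sub>v v)\<rparr>"

definition information_set :: "bit poly \<Rightarrow> nat \<Rightarrow> bit poly vec set \<Rightarrow> nat set \<Rightarrow> bool" where
  "information_set q n C I \<longleftrightarrow>
     I \<subseteq> {..<n} \<and>
     card I = vectorspace.dim (quot_ring q) ((free_mod q n)\<lparr>carrier := C\<rparr>) \<and>
     inj_on (\<lambda>v. restrict (\<lambda>i. v $ i) I) C"


section \<open>Lifted-product codes\<close>

definition cyc :: "nat \<Rightarrow> bit poly" where
  "cyc l = monom 1 l + 1"

text \<open>\<open>f(x\<^sup>-\<^sup>1)\<close>, using that \<open>x\<^sup>-\<^sup>1 = x\<^bsup>l-1\<^esup>\<close> in \<open>R\<close>.\<close>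

definition conj_R :: "nat \<Rightarrow> bit poly \<Rightarrow> bit poly" where
  "conj_R l f = pcompose f (monom 1 (l - 1)) mod cyc l"

definition adj_mat :: "nat \<Rightarrow> bit poly mat \<Rightarrow> bit poly mat" where
  "adj_mat l C = map_mat (conj_R l) (transpose_mat C)"

definition kron :: "bit poly mat \<Rightarrow> bit poly mat \<Rightarrow> bit poly mat" where
  "kron M N = mat (dim_row M * dim_row N) (dim_col M * dim_col N)
     (\<lambda>(i, j). M $$ (i div dim_row N, j div dim_col N) * N $$ (i mod dim_row N, j mod dim_col N))"

definition append_cols :: "bit poly mat \<Rightarrow> bit poly mat \<Rightarrow> bit poly mat" where
  "append_cols M N = four_block_mat M N (0\<^sub>m 0 (dim_col M)) (0\<^sub>m 0 (dim_col N))"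

definition bd1 :: "bit poly mat \<Rightarrow> bit poly mat \<Rightarrow> bit poly mat" where
  "bd1 A B = append_cols (kron A (1\<^sub>m (dim_row B))) (kron (1\<^sub>m (dim_row A)) B)"

definition bd2 :: "bit poly mat \<Rightarrow> bit poly mat \<Rightarrow> bit poly mat" where
  "bd2 A B = kron (1\<^sub>m (dim_col A)) B @\<^sub>r kron A (1\<^sub>m (dim_col B))"

text \<open>\<open>R\<^sup>n\<close> as a vector space over \<open>\<bbbF>\<^sub>2\<close> (its binarization).\<close>

definition bin_space :: "nat \<Rightarrow> nat \<Rightarrow> (bit, bit poly vec) module" where
  "bin_space l n = \<lparr>carrier = vecs (cyc l) n, mult = undefined, one = undefined, zero = 0\<^sub>v n,
     add = (+), smult = \<lambda>c v. map_vec (Polynomial.smult c) v\<rparr>"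

definition quot_space :: "('k, 'v) module \<Rightarrow> 'v set \<Rightarrow> ('k, 'v set) module" where
  "quot_space V W = \<lparr>carrier = a_rcosets\<^bsub>V\<^esub> W, mult = undefined, one = undefined, zero = W,
     add = set_add V, smult = \<lambda>c X. \<Union>v\<in>X. W +>\<^bsub>V\<^esub> (c \<odot>\<^bsub>V\<^esub> v)\<rparr>"

text \<open>For composable \<open>R\<close>-matrices with \<open>D1 D2 = 0\<close>: the quotient \<open>ker D1 / im D2\<close> over \<open>\<bbbF>\<^sub>2\<close>,
  the class of a cycle in it, and sets of cycles representing a basis of it. For
  \<open>D1, D2 = \<partial>\<^sub>1, \<partial>\<^sub>2\<close> this is \<open>H\<^sub>1\<close>, for \<open>D1, D2 = \<partial>\<^sub>2\<^sup>*, \<partial>\<^sub>1\<^sup>*\<close> it is \<open>H\<^sup>1\<close>.\<close>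

definition cycles :: "nat \<Rightarrow> bit poly mat \<Rightarrow> (bit, bit poly vec) module" where
  "cycles l D1 = (bin_space l (dim_col D1))\<lparr>carrier := mat_ker (cyc l) D1\<rparr>"

definition homology :: "nat \<Rightarrow> bit poly mat \<Rightarrow> bit poly mat \<Rightarrow> (bit, bit poly vec set) module" where
  "homology l D1 D2 = quot_space (cycles l D1) (mat_im (cyc l) D2)"

definition hom_class :: "nat \<Rightarrow> bit poly mat \<Rightarrow> bit poly mat \<Rightarrow> bit poly vec \<Rightarrow> bit poly vec set" where
  "hom_class l D1 D2 v = mat_im (cyc l) D2 +>\<^bsub>cycles l D1\<^esub> v"

definition represents_basis ::
    "nat \<Rightarrow> bit poly mat \<Rightarrow> bit poly mat \<Rightarrow> bit poly vec set \<Rightarrow> bool" where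
  "represents_basis l D1 D2 S \<longleftrightarrow>
     S \<subseteq> mat_ker (cyc l) D1 \<and> inj_on (hom_class l D1 D2) S \<and>
     vectorspace.basis class_ring (homology l D1 D2) (hom_class l D1 D2 ` S)"

definition Z_class :: "nat \<Rightarrow> bit poly mat \<Rightarrow> bit poly mat \<Rightarrow> bit poly vec \<Rightarrow> bit poly vec set" where
  "Z_class l A B = hom_class l (bd1 A B) (bd2 A B)"

definition X_class :: "nat \<Rightarrow> bit poly mat \<Rightarrow> bit poly mat \<Rightarrow> bit poly vec \<Rightarrow> bit poly vec set" where
  "X_class l A B = hom_class l (adj_mat l (bd2 A B)) (adj_mat l (bd1 A B))"

definition Z_basis :: "nat \<Rightarrow> bit poly mat \<Rightarrow> bit poly mat \<Rightarrow> bit poly vec set \<Rightarrow> bool" where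
  "Z_basis l A B = represents_basis l (bd1 A B) (bd2 A B)"

definition X_basis :: "nat \<Rightarrow> bit poly mat \<Rightarrow> bit poly mat \<Rightarrow> bit poly vec set \<Rightarrow> bool" where
  "X_basis l A B = represents_basis l (adj_mat l (bd2 A B)) (adj_mat l (bd1 A B))"

definition num_logical :: "nat \<Rightarrow> bit poly mat \<Rightarrow> bit poly mat \<Rightarrow> nat" where
  "num_logical l A B = vectorspace.dim class_ring (homology l (bd1 A B) (bd2 A B))"


section \<open>Canonical LP bases\<close>

definition shifted_rows :: "nat \<Rightarrow> bit poly mat \<Rightarrow> bit poly vec set" where
  "shifted_rows l M = {reduce_vec (cyc l) (monom 1 m \<cdot>\<^sub>v row M j) | m j. m < l \<and> j < dim_row M}"

text \<open>The rows of \<open>L\<^sub>Z\<close> and \<open>L\<^sub>X\<close> for \<open>A \<in> R\<^bsup>mA \<times> nA\<^esup>\<close>, \<open>B \<in> R\<^bsup>mB \<times> nB\<^esup>\<close>, with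
  \<open>rA = nA - mA\<close> and \<open>rB = mB - nB\<close>; the last block is the summand \<open>R\<^bsup>mA nB\<^esup>\<close> of \<open>M\<^sub>1\<close>.\<close>

definition LZ_rows ::
    "nat \<Rightarrow> nat \<Rightarrow> nat \<Rightarrow> nat \<Rightarrow> nat \<Rightarrow> bit poly mat \<Rightarrow> bit poly vec set" where
  "LZ_rows l mA nA mB nB GA = (let rA = nA - mA; rB = mB - nB in
     shifted_rows l (append_cols
       (kron (append_cols (1\<^sub>m rA) GA) (append_cols (1\<^sub>m rB) (0\<^sub>m rB nB)))
       (0\<^sub>m (rA * rB) (mA * nB))))"

definition LX_rows ::
    "nat \<Rightarrow> nat \<Rightarrow> nat \<Rightarrow> nat \<Rightarrow> nat \<Rightarrow> bit poly mat \<Rightarrow> bit poly vec set" where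
  "LX_rows l mA nA mB nB GB = (let rA = nA - mA; rB = mB - nB in
     shifted_rows l (append_cols
       (kron (append_cols (1\<^sub>m rA) (0\<^sub>m rA mA)) (append_cols (1\<^sub>m rB) GB))
       (0\<^sub>m (rA * rB) (mA * nB))))"

text \<open>Permuting the coordinates of \<open>\<A>\<^sub>1\<close> permutes the columns of \<open>A\<close>, and permuting those of
  \<open>\<B>\<^sub>0\<close> permutes the rows of \<open>B\<close>.\<close>

definition permute_cols :: "(nat \<Rightarrow> nat) \<Rightarrow> bit poly mat \<Rightarrow> bit poly mat" where
  "permute_cols p M = mat (dim_row M) (dim_col M) (\<lambda>(i, j). M $$ (i, p j))"

definition permute_rows :: "(nat \<Rightarrow> nat) \<Rightarrow> bit poly mat \<Rightarrow> bit poly mat" where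
  "permute_rows p M = mat (dim_row M) (dim_col M) (\<lambda>(i, j). M $$ (p i, j))"

definition canonical_LP_basis ::
    "nat \<Rightarrow> bit poly mat \<Rightarrow> bit poly mat \<Rightarrow> (nat \<Rightarrow> nat) \<Rightarrow> (nat \<Rightarrow> nat) \<Rightarrow>
     bit poly mat \<Rightarrow> bit poly mat \<Rightarrow> bit poly vec set \<Rightarrow> bit poly vec set \<Rightarrow> bool" where
  "canonical_LP_basis l A B p s GA GB SZ SX \<longleftrightarrow>
     (let mA = dim_row A; nA = dim_col A; mB = dim_row B; nB = dim_col B;
          A' = permute_cols p A; B' = permute_rows s B in
      p permutes {..<nA} \<and> s permutes {..<mB} \<and>
      GA \<in> mats (cyc l) (nA - mA) mA \<and> GB \<in> mats (cyc l) (mB - nB) nB \<and>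
      Z_basis l A' B' SZ \<and> LZ_rows l mA nA mB nB GA \<subseteq> SZ \<and>
      X_basis l A' B' SX \<and> LX_rows l mA nA mB nB GB \<subseteq> SX)"

definition admits_canonical_LP_basis :: "nat \<Rightarrow> bit poly mat \<Rightarrow> bit poly mat \<Rightarrow> bool" where
  "admits_canonical_LP_basis l A B \<longleftrightarrow>
     (\<exists>p s GA GB SZ SX. canonical_LP_basis l A B p s GA GB SZ SX)"


section \<open>The structures used above are fields and vector spaces\<close>

lemma quot_ring_simps [simp]:
  "f \<in> carrier (quot_ring q) \<longleftrightarrow> f mod q = f" "f \<otimes>\<^bsub>quot_ring q\<^esub> g = (f * g) mod q"
  "\<one>\<^bsub>quot_ring q\<^esub> = 1 mod q" "\<zero>\<^bsub>quot_ring q\<^esub> = 0" "f \<oplus>\<^bsub>quot_ring q\<^esub> g = f + g"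
  by (simp_all add: quot_ring_def)

lemma cring_quot_ring: "cring (quot_ring q)"
proof (rule cringI)
  show "abelian_group (quot_ring q)"
  proof (rule abelian_groupI)
    fix x assume "x \<in> carrier (quot_ring q)"
    then show "\<exists>y\<in>carrier (quot_ring q). y \<oplus>\<^bsub>quot_ring q\<^esub> x = \<zero>\<^bsub>quot_ring q\<^esub>"
      by (intro bexI[of _ "- x"]) (auto simp: poly_mod_minus_left)
  qed (auto simp: poly_mod_add_left algebra_simps)
  show "comm_monoid (quot_ring q)"
  proof (rule comm_monoidI)
  qed (auto simp: mod_mult_left_eq mod_mult_right_eq mult_ac mod_mult_right_eq[where b=1, simplified])
qed (auto simp: poly_mod_add_left algebra_simps)

lemma irreducible_bezout:
  fixes q a :: "'a :: field poly"
  assumes "irreducible q" "\<not> q dvd a"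
  shows "\<exists>u v. u * a + v * q = 1"
proof -
  define I where "I = {u * a + v * q | u v. True}"
  have "q = 0 * a + 1 * q" "a = 1 * a + 0 * q" by simp_all
  then have qI: "q \<in> I" and aI: "a \<in> I" unfolding I_def by blast+
  have "q \<noteq> 0" using assms(1) by (simp add: irreducible_def)
  define g where "g = arg_min degree (\<lambda>g. g \<in> I \<and> g \<noteq> 0)"
  have g: "g \<in> I" "g \<noteq> 0" and min: "\<And>f. f \<in> I \<Longrightarrow> f \<noteq> 0 \<Longrightarrow> degree g \<le> degree f"
    using arg_min_natI[of "\<lambda>g. g \<in> I \<and> g \<noteq> 0" q degree]
      arg_min_nat_le[of "\<lambda>g. g \<in> I \<and> g \<noteq> 0" _ degree] qI \<open>q \<noteq> 0\<close> by (auto simp: g_def)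
  have dvd: "g dvd f" if "f \<in> I" for f
  proof -
    obtain u v u' v' where "f = u * a + v * q" "g = u' * a + v' * q"
      using \<open>f \<in> I\<close> g(1) by (auto simp: I_def)
    then have "f mod g = (u - f div g * u') * a + (v - f div g * v') * q"
      by (simp add: minus_div_mult_eq_mod[symmetric] algebra_simps)
    then have "f mod g \<in> I" by (auto simp: I_def)
    then have "f mod g = 0" using min[of "f mod g"] degree_mod_less[of g f] g(2) by force
    then show ?thesis by (simp add: dvd_eq_mod_eq_0)
  qed
  obtain k where k: "q = g * k" using dvd[OF qI] by (auto elim: dvdE)
  then consider "g dvd 1" | "k dvd 1" using irreducibleD[OF assms(1), of g k] by auto
  then show ?thesis
  proof cases
    case 1
    then obtain c where "1 = g * c" by (auto elim: dvdE)
    moreover obtain u v where "g = u * a + v * q" using g(1) by (auto simp: I_def)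
    ultimately have "(c * u) * a + (c * v) * q = 1" by (simp add: algebra_simps)
    then show ?thesis by blast
  next
    case 2
    then have "q dvd g" using k by (simp add: mult_unit_dvd_iff)
    then show ?thesis using dvd[OF aI] assms(2) dvd_trans by blast
  qed
qed

lemma field_quot_ring:
  assumes "irreducible q"
  shows "field (quot_ring q)"
proof -
  interpret cring "quot_ring q" by (rule cring_quot_ring)
  have q: "\<not> is_unit q" using assms by (simp add: irreducible_def)
  show ?thesis
  proof (rule cring_fieldI2)
    show "\<zero>\<^bsub>quot_ring q\<^esub> \<noteq> \<one>\<^bsub>quot_ring q\<^esub>"
      using q by (auto simp: dvd_eq_mod_eq_0)
    fix a assume a: "a \<in> carrier (quot_ring q)" "a \<noteq> \<zero>\<^bsub>quot_ring q\<^esub>"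
    then have "\<not> q dvd a" by (auto simp: dvd_eq_mod_eq_0)
    then obtain u v where "u * a + v * q = 1" using irreducible_bezout[OF assms] by blast
    then have "(u * a) mod q = 1 mod q" by (metis mod_mult_self1 mult.commute)
    then show "\<exists>b\<in>carrier (quot_ring q). a \<otimes>\<^bsub>quot_ring q\<^esub> b = \<one>\<^bsub>quot_ring q\<^esub>"
      by (intro bexI[of _ "u mod q"]) (auto simp: mod_mult_right_eq mult.commute)
  qed
qed

lemma two_bit_poly: "(2 :: bit poly) = 0"
  by (simp add: numeral_poly)

lemma zero_vecs: "0\<^sub>v n \<in> vecs q n"
  by (auto simp: vecs_def)

lemma add_vecs: "u \<in> vecs q n \<Longrightarrow> v \<in> vecs q n \<Longrightarrow> u + v \<in> vecs q n"
  by (auto simp: vecs_def poly_mod_add_left)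

lemma vecs_neg: "v \<in> vecs q n \<Longrightarrow> \<exists>w\<in>vecs q n. v + w = 0\<^sub>v n"
  by (intro bexI[of _ "- v"]) (auto simp: vecs_def)

lemma vectorspace_free_mod:
  assumes "irreducible q"
  shows "vectorspace (quot_ring q) (free_mod q n)"
proof (rule vs_criteria)
  show "\<forall>v\<in>carrier (free_mod q n). \<exists>w\<in>carrier (free_mod q n).
    v \<oplus>\<^bsub>free_mod q n\<^esub> w = \<zero>\<^bsub>free_mod q n\<^esub>"
    by (simp add: free_mod_def vecs_neg)
qed (use field_quot_ring[OF assms] in \<open>auto simp: free_mod_def zero_vecs add_vecs reduce_vec_def
     vecs_def poly_mod_add_left mod_mult_left_eq mod_mult_right_eq algebra_simps intro!: eq_vecI\<close>)

lemma vectorspace_bin_space: "vectorspace class_ring (bin_space l n)"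
proof (rule vs_criteria)
  show "\<forall>v\<in>carrier (bin_space l n). \<exists>w\<in>carrier (bin_space l n).
    v \<oplus>\<^bsub>bin_space l n\<^esub> w = \<zero>\<^bsub>bin_space l n\<^esub>"
    by (simp add: bin_space_def vecs_neg)
  show "field (class_ring :: bit ring)" by (rule class_field.field_axioms)
qed (auto simp: two_bit_poly bin_space_def zero_vecs add_vecs vecs_def
     poly_mod_add_left mod_smult_left smult_add_left smult_add_right algebra_simps intro!: eq_vecI)

lemma mat_app_reduce_vec:
  assumes "v \<in> carrier_vec (dim_col M)"
  shows "mat_app q M (reduce_vec q v) = mat_app q M v"
proof (rule eq_vecI)
  fix i assume "i < dim_vec (mat_app q M v)"
  moreover have "(\<Sum>j\<in>A. M $$ (i, j) * (v $ j mod q)) mod q = (\<Sum>j\<in>A. M $$ (i, j) * v $ j) mod q"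
    for A :: "nat set"
    by (subst (1 2) mod_sum_eq[symmetric]) (simp add: mod_mult_right_eq)
  ultimately show "mat_app q M (reduce_vec q v) $ i = mat_app q M v $ i"
    using assms by (simp add: mat_app_def reduce_vec_def scalar_prod_def)
qed (simp add: mat_app_def reduce_vec_def)

lemma mat_app_add:
  assumes "u \<in> carrier_vec (dim_col M)" "v \<in> carrier_vec (dim_col M)"
  shows "mat_app q M (u + v) = mat_app q M u + mat_app q M v"
  using assms by (intro eq_vecI)
    (auto simp: mat_app_def reduce_vec_def poly_mod_add_left scalar_prod_add_distrib[of _ "dim_col M"])

lemma mat_app_smult:
  assumes "v \<in> carrier_vec (dim_col M)"
  shows "mat_app q M (c \<cdot>\<^sub>v v) = reduce_vec q (c \<cdot>\<^sub>v mat_app q M v)"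
  using assms by (intro eq_vecI) (auto simp: mat_app_def reduce_vec_def mod_mult_right_eq)

lemma subspace_mat_ker:
  assumes "irreducible q"
  shows "subspace (quot_ring q) (mat_ker q M) (free_mod q (dim_col M))"
proof -
  have vs: "vectorspace (quot_ring q) (free_mod q (dim_col M))"
    by (rule vectorspace_free_mod[OF assms])
  have "submodule (quot_ring q) (mat_ker q M) (free_mod q (dim_col M))"
  proof (rule submodule.intro)
    show "module (quot_ring q) (free_mod q (dim_col M))"
      using vs by (rule vectorspace.axioms)
  next
    fix c v assume "v \<in> mat_ker q M"
    then have "v \<in> carrier_vec (dim_col M)" "mat_app q M v = 0\<^sub>v (dim_row M)"
      by (auto simp: mat_ker_def vecs_def)
    then have "mat_app q M (reduce_vec q (c \<cdot>\<^sub>v v)) = 0\<^sub>v (dim_row M)"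
      by (simp add: mat_app_reduce_vec mat_app_smult) (auto simp: reduce_vec_def)
    then show "c \<odot>\<^bsub>free_mod q (dim_col M)\<^esub> v \<in> mat_ker q M"
      using \<open>v \<in> carrier_vec (dim_col M)\<close>
      by (auto simp: mat_ker_def free_mod_def) (auto simp: vecs_def reduce_vec_def)
  next
    show "\<zero>\<^bsub>free_mod q (dim_col M)\<^esub> \<in> mat_ker q M"
      by (auto simp: mat_ker_def free_mod_def zero_vecs mat_app_def reduce_vec_def)
  next
    fix u v assume uv: "u \<in> mat_ker q M" "v \<in> mat_ker q M"
    then have "u \<in> carrier_vec (dim_col M)" "v \<in> carrier_vec (dim_col M)"
      by (auto simp: mat_ker_def vecs_def)
    with uv show "u \<oplus>\<^bsub>free_mod q (dim_col M)\<^esub> v \<in> mat_ker q M"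
      by (simp add: mat_ker_def free_mod_def add_vecs mat_app_add)
  qed (simp add: mat_ker_def free_mod_def)
  then show ?thesis using vs by (simp add: subspace_def)
qed

lemma vectorspace_quot_space:
  assumes "subspace K W V"
  shows "vectorspace K (quot_space V W)"
proof -
  interpret V: vectorspace K V using assms by (simp add: subspace_def)
  interpret W: LinearCombinations.submodule K W V using assms by (simp add: subspace_def)
  have Wsub: "w \<in> carrier V" if "w \<in> W" for w using W.subset that by blast
  have inv: "inv\<^bsub>add_monoid V\<^esub> w \<in> W" if "w \<in> W" for w
  proof -
    have "(\<ominus>\<^bsub>K\<^esub> \<one>\<^bsub>K\<^esub>) \<odot>\<^bsub>V\<^esub> w = \<ominus>\<^bsub>V\<^esub> w"
      using Wsub[OF that] by (simp add: V.smult_l_minus)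
    then show ?thesis using that W.smult_closed[of "\<ominus>\<^bsub>K\<^esub> \<one>\<^bsub>K\<^esub>" w] by (simp add: a_inv_def)
  qed
  have "subgroup W (add_monoid V)"
    by (rule subgroup.intro) (use W.subset inv in auto)
  then interpret S: abelian_subgroup W V
    by (intro abelian_subgroupI3 additive_subgroup.intro V.abelian_group_axioms)
  have rep: "\<exists>v\<in>carrier V. X = W +>\<^bsub>V\<^esub> v" if "X \<in> a_rcosets\<^bsub>V\<^esub> W" for X
    using that by (auto simp: A_RCOSETS_def RCOSETS_def a_r_coset_def)
  have in_coset: "u \<in> W +>\<^bsub>V\<^esub> v \<longleftrightarrow> (\<exists>w\<in>W. u = w \<oplus>\<^bsub>V\<^esub> v)" for u v
    by (simp add: a_r_coset_def')
  have sm: "c \<odot>\<^bsub>quot_space V W\<^esub> (W +>\<^bsub>V\<^esub> v) = W +>\<^bsub>V\<^esub> (c \<odot>\<^bsub>V\<^esub> v)"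
    if c: "c \<in> carrier K" and v: "v \<in> carrier V" for c v
  proof -
    have "W +>\<^bsub>V\<^esub> (c \<odot>\<^bsub>V\<^esub> u) = W +>\<^bsub>V\<^esub> (c \<odot>\<^bsub>V\<^esub> v)" if "u \<in> W +>\<^bsub>V\<^esub> v" for u
    proof -
      from that have "\<exists>w\<in>W. u = w \<oplus>\<^bsub>V\<^esub> v" by (simp only: in_coset)
      then obtain w where w: "w \<in> W" "u = w \<oplus>\<^bsub>V\<^esub> v" by (rule bexE)
      then have "c \<odot>\<^bsub>V\<^esub> u = (c \<odot>\<^bsub>V\<^esub> w) \<oplus>\<^bsub>V\<^esub> (c \<odot>\<^bsub>V\<^esub> v)"
        using c v Wsub by (simp add: V.smult_r_distr)
      then have "c \<odot>\<^bsub>V\<^esub> u \<in> W +>\<^bsub>V\<^esub> (c \<odot>\<^bsub>V\<^esub> v)"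
        unfolding in_coset using w(1) c by (intro bexI[of _ "c \<odot>\<^bsub>V\<^esub> w"]) simp_all
      then show ?thesis
        by (rule V.a_repr_independence[OF _ _ \<open>subgroup W (add_monoid V)\<close>, symmetric]) (simp add: c v)
    qed
    then have "(\<Union>u\<in>W +>\<^bsub>V\<^esub> v. W +>\<^bsub>V\<^esub> (c \<odot>\<^bsub>V\<^esub> u)) = (\<Union>u\<in>W +>\<^bsub>V\<^esub> v. W +>\<^bsub>V\<^esub> (c \<odot>\<^bsub>V\<^esub> v))"
      by (rule SUP_cong[OF refl])
    moreover have "W +>\<^bsub>V\<^esub> v \<noteq> {}" using S.a_rcos_self[OF v] by (metis empty_iff)
    ultimately show ?thesis by (simp add: quot_space_def)
  qed
  have [simp]: "carrier (quot_space V W) = a_rcosets\<^bsub>V\<^esub> W" "\<zero>\<^bsub>quot_space V W\<^esub> = W +>\<^bsub>V\<^esub> \<zero>\<^bsub>V\<^esub>"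
    "X \<oplus>\<^bsub>quot_space V W\<^esub> Y = X <+>\<^bsub>V\<^esub> Y" for X Y
    using W.subset by (simp_all add: quot_space_def V.a_coset_add_zero)
  have cl: "W +>\<^bsub>V\<^esub> v \<in> a_rcosets\<^bsub>V\<^esub> W" if "v \<in> carrier V" for v
    using V.a_rcosetsI[OF W.subset that] .

  have carr: "carrier (quot_space V W) = a_rcosets\<^bsub>V\<^esub> W" by simp
  have ex: "(\<forall>X\<in>a_rcosets\<^bsub>V\<^esub> W. P X) \<longleftrightarrow> (\<forall>v\<in>carrier V. P (W +>\<^bsub>V\<^esub> v))" for P
    using rep cl by metis
  have ex2: "(\<forall>X Y. X \<in> a_rcosets\<^bsub>V\<^esub> W \<and> Y \<in> a_rcosets\<^bsub>V\<^esub> W \<longrightarrow> P X Y) \<longleftrightarrow>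
    (\<forall>u\<in>carrier V. \<forall>v\<in>carrier V. P (W +>\<^bsub>V\<^esub> u) (W +>\<^bsub>V\<^esub> v))" for P
    using rep cl by metis
  have ex3: "(\<forall>X Y Z. X \<in> a_rcosets\<^bsub>V\<^esub> W \<and> Y \<in> a_rcosets\<^bsub>V\<^esub> W \<and> Z \<in> a_rcosets\<^bsub>V\<^esub> W \<longrightarrow> P X Y Z) \<longleftrightarrow>
    (\<forall>u\<in>carrier V. \<forall>v\<in>carrier V. \<forall>w\<in>carrier V. P (W +>\<^bsub>V\<^esub> u) (W +>\<^bsub>V\<^esub> v) (W +>\<^bsub>V\<^esub> w))" for P
    using rep cl by metis
  have exc: "(\<forall>c X. c \<in> carrier K \<and> X \<in> a_rcosets\<^bsub>V\<^esub> W \<longrightarrow> P c X) \<longleftrightarrow>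
    (\<forall>c\<in>carrier K. \<forall>v\<in>carrier V. P c (W +>\<^bsub>V\<^esub> v))" for P
    using rep cl by metis
  have excc: "(\<forall>c d X. c \<in> carrier K \<and> d \<in> carrier K \<and> X \<in> a_rcosets\<^bsub>V\<^esub> W \<longrightarrow> P c d X) \<longleftrightarrow>
    (\<forall>c\<in>carrier K. \<forall>d\<in>carrier K. \<forall>v\<in>carrier V. P c d (W +>\<^bsub>V\<^esub> v))" for P
    using rep cl by metis
  have excx: "(\<forall>c X Y. c \<in> carrier K \<and> X \<in> a_rcosets\<^bsub>V\<^esub> W \<and> Y \<in> a_rcosets\<^bsub>V\<^esub> W \<longrightarrow> P c X Y) \<longleftrightarrow>
    (\<forall>c\<in>carrier K. \<forall>u\<in>carrier V. \<forall>v\<in>carrier V. P c (W +>\<^bsub>V\<^esub> u) (W +>\<^bsub>V\<^esub> v))" for P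
    using rep cl by metis
  show ?thesis
  proof (rule vs_criteria, unfold carr ex ex2 ex3 exc excc excx)
    show "field K" by (rule V.field_axioms)
    show "\<forall>v\<in>carrier V. \<exists>Y\<in>a_rcosets\<^bsub>V\<^esub> W.
        (W +>\<^bsub>V\<^esub> v) \<oplus>\<^bsub>quot_space V W\<^esub> Y = \<zero>\<^bsub>quot_space V W\<^esub>"
    proof
      fix v assume "v \<in> carrier V"
      then show "\<exists>Y\<in>a_rcosets\<^bsub>V\<^esub> W. (W +>\<^bsub>V\<^esub> v) \<oplus>\<^bsub>quot_space V W\<^esub> Y = \<zero>\<^bsub>quot_space V W\<^esub>"
        by (intro bexI[of _ "W +>\<^bsub>V\<^esub> (\<ominus>\<^bsub>V\<^esub> v)"]) (simp_all add: S.a_rcos_sum cl V.r_neg)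
    qed
  qed (simp_all add: cl sm S.a_rcos_sum V.a_assoc V.a_comm V.a_lcomm V.smult_l_distr V.smult_r_distr V.smult_assoc1
      del: V.a_coset_add_zero)
qed

end

theory Submission
  imports Defs
begin

text \<open>Call a set \<open>J\<close> of coordinates free for a kernel if restriction to \<open>J\<close> is surjective. Over a finite
  field, counting shows that an information set is a free set on which restriction is also injective,
  i.e. a maximal free set; hence a set is free if and only if it lies in an information set.
  By the Chinese remainder theorem (\<open>x\<^sup>l + 1\<close> is squarefree as \<open>l\<close> is odd), \<open>J\<close> is free for every
  component of \<open>ker A\<close> if and only if it is free for \<open>ker A\<close> over \<open>R\<close>, which for \<open>|J| = r\<^sub>A\<close> says that
  \<open>ker A\<close> contains the rows of some \<open>(I, G\<^sub>A\<^sup>0)\<close>, up to moving \<open>J\<close> to the front.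

  So it remains to see that a canonical basis exists as soon as the rows of \<open>L\<^sub>Z\<close> and \<open>L\<^sub>X\<close> are cycles
  and cocycles. The sesquilinear pairing \<open>\<Sum> u\<^sub>k w\<^sub>k\<^sup>*\<close> with values in \<open>R\<close> descends to \<open>H\<^sub>1 \<times> H\<^sup>1\<close>, and
  the two families of rows are dual to each other under it. Therefore their classes are linearly
  independent and extend to bases.\<close>

section \<open>Information sets and surjective restrictions\<close>

text \<open>The components of \<open>A\<close> may have different ranks, so their kernels can have
  different dimensions, possibly above \<open>nA - mA\<close>. What is shared between components is
  a set of exactly \<open>nA - mA\<close> coordinates inside all information sets; freeness is
  inherited by such a set and still makes sense over R, which need not be a field. Two twists
  separate the components from the complex. The root \<open>\<beta> i\<close> is arbitrary, so
  \<open>component\<close> amounts to reduction modulo \<open>b i\<close> followed by a field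
  automorphism, which does not affect free sets. And cocycles involve \<open>adj_mat l B\<close>,
  while the information sets belong to the transpose of \<open>B\<close>; conjugation may
  interchange the factors \<open>b i\<close>, so it is removed over R, where it is an automorphism.
  Since homology is treated as a space over F_2, the R-valued pairing is split into its l
  coefficients: pairing is linear over R in its first argument, so they tell the l shifts of a row
  apart. Finally, the bases belong to permuted matrices but k to the original ones. Hence the tensor
  families carry the positions of their unit entries as parameters.\<close>

lemma finite_bit: "finite (UNIV :: bit set)"
proof (rule finite_subset)
  show "(UNIV :: bit set) \<subseteq> {0, 1}" using bit_not_zero_iff by blast
qed simp

lemma finite_carrier_quot_ring:
  assumes "q \<noteq> 0"
  shows "finite (carrier (quot_ring q))"
proof -
  let ?F = "{..degree q} \<rightarrow>\<^sub>E (UNIV :: bit set)"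
  have "inj_on (\<lambda>f. restrict (coeff f) {..degree q}) (carrier (quot_ring q))"
  proof (rule inj_onI)
    fix f g assume f: "f \<in> carrier (quot_ring q)" and g: "g \<in> carrier (quot_ring q)"
      and eq: "restrict (coeff f) {..degree q} = restrict (coeff g) {..degree q}"
    have deg: "degree h \<le> degree q" if "h \<in> carrier (quot_ring q)" for h
      using that degree_mod_less[OF assms, of h] by auto
    show "f = g"
    proof (rule poly_eqI)
      fix n
      show "coeff f n = coeff g n"
      proof (cases "n \<le> degree q")
        case True
        then show ?thesis using fun_cong[OF eq, of n] by simp
      next
        case False
        then show ?thesis using deg[OF f] deg[OF g] by (simp add: coeff_eq_0)
      qed
    qed
  qed
  moreover have "finite ((\<lambda>f. restrict (coeff f) {..degree q}) ` carrier (quot_ring q))"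
    by (rule finite_subset[of _ ?F]) (use finite_bit in \<open>auto simp: finite_PiE split: if_splits\<close>)
  ultimately show ?thesis by (rule finite_imageD[rotated])
qed

lemma finite_vecs:
  assumes "q \<noteq> 0"
  shows "finite (vecs q n)"
proof -
  have "vecs q n \<subseteq> (\<lambda>f. vec n f) ` ({..<n} \<rightarrow>\<^sub>E carrier (quot_ring q))"
  proof
    fix v assume v: "v \<in> vecs q n"
    then have "v = vec n (restrict (($) v) {..<n})" by (auto simp: vecs_def)
    moreover have "restrict (($) v) {..<n} \<in> {..<n} \<rightarrow>\<^sub>E carrier (quot_ring q)"
      using v by (auto simp: vecs_def)
    ultimately show "v \<in> (\<lambda>f. vec n f) ` ({..<n} \<rightarrow>\<^sub>E carrier (quot_ring q))" by blast
  qed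
  then show ?thesis
    by (rule finite_subset) (simp add: finite_PiE finite_carrier_quot_ring[OF assms])
qed

lemma (in vectorspace) fin_dim_finite:
  assumes "finite (carrier V)"
  shows fin_dim
proof -
  have "span (carrier V) = carrier V"
    using span_closed[of "carrier V"] span_mem[of "carrier V"] by blast
  then show ?thesis using assms unfolding fin_dim_def by blast
qed

lemma (in vectorspace) card_carrier_dim:
  assumes "finite (carrier V)"
  shows "card (carrier V) = card (carrier K) ^ dim"
proof -
  obtain S where S: "finite S" "basis S"
    using finite_basis_exists[OF fin_dim_finite[OF assms]] by blast
  have sub: "S \<subseteq> carrier V" using S(2) by (simp add: basis_def)
  have uniq: "\<exists>!a. a \<in> S \<rightarrow>\<^sub>E carrier K \<and> lincomb a S = v" if "v \<in> carrier V" for v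
    using basis_criterion[OF S(1) sub] S(2) that by blast
  have "bij_betw (\<lambda>a. lincomb a S) (S \<rightarrow>\<^sub>E carrier K) (carrier V)"
  proof (rule bij_betwI')
    fix a c assume ac: "a \<in> S \<rightarrow>\<^sub>E carrier K" "c \<in> S \<rightarrow>\<^sub>E carrier K"
    then have "lincomb a S \<in> carrier V" using sub by (intro lincomb_closed) auto
    then show "(lincomb a S = lincomb c S) = (a = c)" using uniq ac by metis
  next
    fix a assume "a \<in> S \<rightarrow>\<^sub>E carrier K"
    then show "lincomb a S \<in> carrier V" using sub by (intro lincomb_closed) auto
  next
    fix v assume "v \<in> carrier V"
    then show "\<exists>a\<in>S \<rightarrow>\<^sub>E carrier K. v = lincomb a S" using uniq by metis
  qed
  then have "card (carrier V) = card (S \<rightarrow>\<^sub>E carrier K)" by (simp add: bij_betw_same_card)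
  then show ?thesis using S by (simp add: card_PiE dim_basis)
qed

text \<open>From here on kernels are handled through divisibility of sums in F_2[x], so that
  intermediate expressions need no reduction.\<close>

lemma mat_ker_iff:
  "v \<in> mat_ker q M \<longleftrightarrow> v \<in> vecs q (dim_col M) \<and>
     (\<forall>i<dim_row M. q dvd (\<Sum>j<dim_col M. M $$ (i, j) * v $ j))"
proof (cases "v \<in> vecs q (dim_col M)")
  case True
  then have "dim_vec v = dim_col M" by (simp add: vecs_def)
  then have "mat_app q M v = 0\<^sub>v (dim_row M) \<longleftrightarrow>
      (\<forall>i<dim_row M. q dvd (\<Sum>j<dim_col M. M $$ (i, j) * v $ j))"
    by (auto simp: mat_app_def reduce_vec_def vec_eq_iff dvd_eq_mod_eq_0 scalar_prod_def
        lessThan_atLeast0)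
  then show ?thesis using True by (simp add: mat_ker_def)
qed (simp add: mat_ker_def)

lemma dvd_sum_mod_iff:
  fixes q :: "bit poly"
  shows "q dvd (\<Sum>j\<in>S. m j * (c j mod q)) \<longleftrightarrow> q dvd (\<Sum>j\<in>S. m j * c j)"
proof -
  have "(\<Sum>j\<in>S. m j * (c j mod q)) mod q = (\<Sum>j\<in>S. m j * c j) mod q"
    by (subst (1 2) mod_sum_eq[symmetric]) (simp add: mod_mult_right_eq)
  then show ?thesis by (simp add: dvd_eq_mod_eq_0)
qed

text \<open>Kernel vectors are constructed from arbitrary polynomials \<open>c j\<close> and reduced
  only once, by this rule.\<close>

lemma vec_mod_mat_ker_iff:
  "vec (dim_col M) (\<lambda>j. c j mod q) \<in> mat_ker q M \<longleftrightarrow>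
     (\<forall>i<dim_row M. q dvd (\<Sum>j<dim_col M. M $$ (i, j) * c j))"
proof -
  have "vec (dim_col M) (\<lambda>j. c j mod q) \<in> vecs q (dim_col M)" by (simp add: vecs_def)
  moreover have "(\<Sum>j<dim_col M. M $$ (i, j) * vec (dim_col M) (\<lambda>j. c j mod q) $ j) =
      (\<Sum>j<dim_col M. M $$ (i, j) * (c j mod q))" for i
    by (rule sum.cong) auto
  ultimately show ?thesis unfolding mat_ker_iff by (simp add: dvd_sum_mod_iff)
qed

text \<open>Phrased for an arbitrary modulus, so that the same notion applies to each
  \<open>b i\<close> and to \<open>cyc l\<close>. Letting \<open>f\<close> be any function and
  reducing its values avoids restricting to functions on \<open>I\<close>.\<close>

definition free_on :: "bit poly \<Rightarrow> bit poly vec set \<Rightarrow> nat set \<Rightarrow> bool" where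
  "free_on q C I \<longleftrightarrow> (\<forall>f. \<exists>c\<in>C. \<forall>i\<in>I. c $ i = f i mod q)"

lemma card_mat_ker:
  assumes "irreducible q"
  shows "card (mat_ker q M) = card (carrier (quot_ring q)) ^
    vectorspace.dim (quot_ring q) ((free_mod q (dim_col M))\<lparr>carrier := mat_ker q M\<rparr>)"
proof -
  have vs: "vectorspace (quot_ring q) ((free_mod q (dim_col M))\<lparr>carrier := mat_ker q M\<rparr>)"
    using vectorspace.subspace_is_vs[OF vectorspace_free_mod subspace_mat_ker] assms by blast
  have "finite (mat_ker q M)"
    using assms by (intro finite_subset[OF _ finite_vecs[of q "dim_col M"]])
      (auto simp: mat_ker_def irreducible_def)
  then show ?thesis using vectorspace.card_carrier_dim[OF vs] by simp
qed

lemma card_quot_ring_gt_1: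
  assumes "irreducible q"
  shows "1 < card (carrier (quot_ring q))"
proof -
  have "q \<noteq> 0" "\<not> q dvd 1" using assms by (auto simp: irreducible_def)
  then have "1 mod q \<noteq> 0" "{0, 1 mod q} \<subseteq> carrier (quot_ring q)"
    by (auto simp: dvd_eq_mod_eq_0)
  then show ?thesis
    using card_mono[OF finite_carrier_quot_ring[OF \<open>q \<noteq> 0\<close>], of "{0, 1 mod q}"] by simp
qed

text \<open>The kernel has |K|^dim elements and there are |K|^|I| functions from \<open>I\<close> to
  the field K. Once restriction is injective, equality of these two finite numbers is the same as
  surjectivity.\<close>

lemma information_set_iff:
  assumes "irreducible q" "I \<subseteq> {..<dim_col M}"
  shows "information_set q (dim_col M) (mat_ker q M) I \<longleftrightarrow>
    inj_on (\<lambda>v. restrict (($) v) I) (mat_ker q M) \<and> free_on q (mat_ker q M) I"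
proof -
  let ?K = "carrier (quot_ring q)" and ?r = "\<lambda>v. restrict (\<lambda>i. (v :: bit poly vec) $ i) I"
  let ?C = "mat_ker q M"
  let ?d = "vectorspace.dim (quot_ring q) ((free_mod q (dim_col M))\<lparr>carrier := ?C\<rparr>)"
  have q0: "q \<noteq> 0" using assms(1) by auto
  have finI: "finite I" using assms(2) finite_subset by blast
  have sub: "?r ` ?C \<subseteq> I \<rightarrow>\<^sub>E ?K"
    using assms(2) by (auto simp: mat_ker_def vecs_def)
  have fin: "finite (I \<rightarrow>\<^sub>E ?K)"
    by (simp add: finite_PiE finI finite_carrier_quot_ring[OF q0])
  have cardPi: "card (I \<rightarrow>\<^sub>E ?K) = card ?K ^ card I" by (simp add: card_PiE finI)
  have free: "free_on q ?C I \<longleftrightarrow> ?r ` ?C = I \<rightarrow>\<^sub>E ?K"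
  proof
    assume fr: "free_on q ?C I"
    show "?r ` ?C = I \<rightarrow>\<^sub>E ?K"
    proof (rule subset_antisym[OF sub], rule subsetI)
      fix f assume f: "f \<in> I \<rightarrow>\<^sub>E ?K"
      from fr obtain c where c: "c \<in> ?C" "\<forall>i\<in>I. c $ i = f i mod q"
        unfolding free_on_def by blast
      have "?r c = f"
      proof
        fix i
        show "?r c i = f i"
          using c(2) f PiE_mem[OF f, of i] PiE_arb[OF f, of i] by (cases "i \<in> I") auto
      qed
      then show "f \<in> ?r ` ?C" using c(1) by blast
    qed
  next
    assume eq: "?r ` ?C = I \<rightarrow>\<^sub>E ?K"
    show "free_on q ?C I"
      unfolding free_on_def
    proof
      fix f :: "nat \<Rightarrow> bit poly"
      have "restrict (\<lambda>i. f i mod q) I \<in> I \<rightarrow>\<^sub>E ?K" by auto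
      then obtain c where c: "c \<in> ?C" "restrict (\<lambda>i. f i mod q) I = ?r c" using eq by blast
      have "\<forall>i\<in>I. c $ i = f i mod q"
      proof
        fix i assume "i \<in> I"
        then show "c $ i = f i mod q" using fun_cong[OF c(2), of i] by simp
      qed
      with c(1) show "\<exists>c\<in>?C. \<forall>i\<in>I. c $ i = f i mod q" by blast
    qed
  qed
  \<comment> \<open>Powers of \<open>card ?K\<close> determine their exponents because the field has
    more than one element.\<close>
  have card: "card I = ?d \<longleftrightarrow> card (I \<rightarrow>\<^sub>E ?K) = card ?C"
    using card_quot_ring_gt_1[OF assms(1)]
    by (simp add: cardPi card_mat_ker[OF assms(1)])
  have "card (I \<rightarrow>\<^sub>E ?K) = card ?C \<longleftrightarrow> ?r ` ?C = I \<rightarrow>\<^sub>E ?K" if inj: "inj_on ?r ?C"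
    using card_image[OF inj] card_subset_eq[OF fin sub] by metis
  then show ?thesis
    unfolding information_set_def free card using assms(2) by blast
qed

lemma free_on_subset: "free_on q C I \<Longrightarrow> J \<subseteq> I \<Longrightarrow> free_on q C J"
  unfolding free_on_def by blast

text \<open>A free superset of largest size is an information set: if two kernel vectors agreed on
  it without being equal, their difference would allow one more coordinate to be prescribed.\<close>

lemma free_on_extend:
  assumes q: "irreducible q" and J: "J \<subseteq> {..<dim_col M}" and free: "free_on q (mat_ker q M) J"
  shows "\<exists>I. J \<subseteq> I \<and> information_set q (dim_col M) (mat_ker q M) I"
proof -
  let ?C = "mat_ker q M"
  define P where "P = (\<lambda>I. J \<subseteq> I \<and> I \<subseteq> {..<dim_col M} \<and> free_on q ?C I)"
  have "P I \<longrightarrow> card I < Suc (dim_col M)" for I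
    using card_mono[of "{..<dim_col M}" I] by (auto simp: P_def)
  moreover have "P J" using J free by (simp add: P_def)
  ultimately obtain I where I: "P I" and max: "\<forall>I'. P I' \<longrightarrow> card I' \<le> card I"
    using ex_has_greatest_nat[of P J card "Suc (dim_col M)"] by blast
  have finI: "finite I" using I finite_subset unfolding P_def by blast
  have freeI: "free_on q ?C I" using I by (simp add: P_def)
  have "inj_on (\<lambda>v. restrict (($) v) I) ?C"
  proof (rule ccontr)
    assume "\<not> inj_on (\<lambda>v. restrict (($) v) I) ?C"
    then obtain u v where uv: "u \<in> ?C" "v \<in> ?C" "u \<noteq> v"
      and eq: "restrict (($) u) I = restrict (($) v) I"
      unfolding inj_on_def by blast
    have eqI: "u $ i = v $ i" if "i \<in> I" for i using fun_cong[OF eq, of i] that by simp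
    have "dim_vec u = dim_col M" "dim_vec v = dim_col M" using uv by (auto simp: mat_ker_def vecs_def)
    then have "\<not> (\<forall>k<dim_col M. u $ k = v $ k)" using uv(3) eq_vecI[of v u] by auto
    then obtain k where k: "k < dim_col M" "u $ k \<noteq> v $ k" by blast
    then have kI: "k \<notin> I" using eqI by auto
    have "u $ k mod q = u $ k" "v $ k mod q = v $ k"
      using uv k(1) by (auto simp: mat_ker_def vecs_def)
    then have "(u $ k - v $ k) mod q = u $ k - v $ k" by (simp add: poly_mod_diff_left)
    then have "\<not> q dvd u $ k - v $ k" using k(2) by (auto simp: dvd_eq_mod_eq_0)
    then obtain a a' where a: "a * (u $ k - v $ k) + a' * q = 1"
      using irreducible_bezout[OF q] by blast
    have "free_on q ?C (insert k I)"
      unfolding free_on_def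
    proof
      fix f :: "nat \<Rightarrow> bit poly"
      obtain c where c: "c \<in> ?C" "\<forall>i\<in>I. c $ i = f i mod q"
        using freeI unfolding free_on_def by blast
      \<comment> \<open>\<open>a\<close> inverts \<open>u $ k - v $ k\<close> modulo
        \<open>q\<close>, so adding \<open>s\<close> times \<open>u - v\<close> moves coordinate
        \<open>k\<close> to \<open>f k\<close> and leaves the coordinates in \<open>I\<close>
        alone.\<close>
      define s where "s = (f k - c $ k) * a"
      define w where "w = (\<lambda>j. c $ j + s * (u $ j - v $ j))"
      have mem: "vec (dim_col M) (\<lambda>j. w j mod q) \<in> ?C"
        unfolding vec_mod_mat_ker_iff
      proof (intro allI impI)
        fix i assume i: "i < dim_row M"
        have "(\<Sum>j<dim_col M. M $$ (i, j) * w j) = (\<Sum>j<dim_col M. M $$ (i, j) * c $ j) +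
            s * ((\<Sum>j<dim_col M. M $$ (i, j) * u $ j) - (\<Sum>j<dim_col M. M $$ (i, j) * v $ j))"
          unfolding sum_distrib_left sum_subtractf[symmetric] sum.distrib[symmetric]
          by (rule sum.cong) (simp_all add: w_def algebra_simps)
        also have "q dvd \<dots>"
          using c(1) uv i by (intro dvd_add dvd_mult dvd_diff) (auto simp: mat_ker_iff)
        finally show "q dvd (\<Sum>j<dim_col M. M $$ (i, j) * w j)" .
      qed
      have "w k = f k - (f k - c $ k) * a' * q"
      proof -
        have "w k = c $ k + (f k - c $ k) * (a * (u $ k - v $ k))"
          by (simp add: w_def s_def mult.assoc)
        also have "a * (u $ k - v $ k) = 1 - a' * q" using a by (metis add_diff_cancel_right')
        finally show ?thesis by (simp add: algebra_simps)
      qed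
      then have wk: "w k mod q = f k mod q" by (simp add: poly_mod_diff_left)
      have wi: "w i mod q = f i mod q" if "i \<in> I" for i
        using eqI[OF that] c(2) that by (simp add: w_def)
      have "\<forall>i\<in>insert k I. vec (dim_col M) (\<lambda>j. w j mod q) $ i = f i mod q"
        using wk wi k(1) I by (auto simp: P_def)
      with mem show "\<exists>c\<in>?C. \<forall>i\<in>insert k I. c $ i = f i mod q" by blast
    qed
    then have "P (insert k I)" using I k(1) by (auto simp: P_def)
    then have "card (insert k I) \<le> card I" using max by blast
    then show False using kI finI by simp
  qed
  then show ?thesis
    using information_set_iff[OF q, of I M] freeI I by (auto simp: P_def)
qed

section \<open>Components and the Chinese remainder theorem\<close>

lemma eval_quot_add: "eval_quot q \<beta> (f + g) = eval_quot q \<beta> f + eval_quot q \<beta> g"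
  by (simp add: eval_quot_def pcompose_add poly_mod_add_left)

lemma eval_quot_diff: "eval_quot q \<beta> (f - g) = eval_quot q \<beta> f - eval_quot q \<beta> g"
  by (simp add: eval_quot_def pcompose_diff poly_mod_diff_left)

lemma eval_quot_0: "eval_quot q \<beta> 0 = 0"
  by (simp add: eval_quot_def)

lemma eval_quot_mult: "eval_quot q \<beta> (f * g) = (eval_quot q \<beta> f * eval_quot q \<beta> g) mod q"
  by (simp add: eval_quot_def pcompose_mult mod_mult_eq)

lemma eval_quot_mod_self: "eval_quot q \<beta> f mod q = eval_quot q \<beta> f"
  by (simp add: eval_quot_def)

text \<open>Evaluation at a root of \<open>q\<close> is a ring homomorphism from F_2[x] whose kernel
  contains \<open>q\<close> but not 1. The ideal generated by the irreducible \<open>q\<close> is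
  maximal, so the kernel is exactly this ideal, and evaluation induces an injective endomorphism of
  F_2[x]/(q).\<close>

lemma eval_quot_eq_0_iff:
  assumes "irreducible q" "eval_quot q \<beta> q = 0"
  shows "eval_quot q \<beta> f = 0 \<longleftrightarrow> q dvd f"
proof
  assume "q dvd f"
  then show "eval_quot q \<beta> f = 0" using assms(2) by (auto simp: eval_quot_mult elim!: dvdE)
next
  assume f: "eval_quot q \<beta> f = 0"
  show "q dvd f"
  proof (rule ccontr)
    assume "\<not> q dvd f"
    then obtain u v where "u * f + v * q = 1" using irreducible_bezout[OF assms(1)] by blast
    then have "eval_quot q \<beta> 1 = eval_quot q \<beta> (u * f + v * q)" by simp
    also have "\<dots> = 0" by (simp add: eval_quot_add eval_quot_mult f assms(2))
    finally have "q dvd 1" by (simp add: eval_quot_def pcompose_1 dvd_eq_mod_eq_0)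
    then show False using assms(1) by (simp add: irreducible_def)
  qed
qed

lemma eval_quot_eq_iff:
  assumes "irreducible q" "eval_quot q \<beta> q = 0"
  shows "eval_quot q \<beta> f = eval_quot q \<beta> g \<longleftrightarrow> f mod q = g mod q"
proof -
  have "f mod q = g mod q \<longleftrightarrow> (f - g) mod q = 0" by (simp add: poly_mod_diff_left)
  then show ?thesis
    using eval_quot_eq_0_iff[OF assms, of "f - g"] by (simp add: eval_quot_diff dvd_eq_mod_eq_0)
qed

text \<open>An injective self-map of a finite set is onto, so the induced endomorphism is an
  automorphism.\<close>

lemma eval_quot_surj:
  assumes "irreducible q" "eval_quot q \<beta> q = 0"
  shows "\<exists>g. eval_quot q \<beta> g = f mod q"
proof -
  let ?K = "carrier (quot_ring q)"
  have "finite ?K" using assms(1) by (intro finite_carrier_quot_ring) auto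
  moreover have "eval_quot q \<beta> ` ?K \<subseteq> ?K" by (auto simp: eval_quot_mod_self)
  moreover have "inj_on (eval_quot q \<beta>) ?K"
    by (rule inj_onI) (simp add: eval_quot_eq_iff[OF assms])
  ultimately have "eval_quot q \<beta> ` ?K = ?K" by (rule endo_inj_surj)
  moreover have "f mod q \<in> ?K" by simp
  ultimately show ?thesis by (metis imageE)
qed

lemma dvd_component_sum_iff:
  assumes "irreducible q" "eval_quot q \<beta> q = 0" "i < dim_row M"
  shows "q dvd (\<Sum>j<dim_col M. component q \<beta> M $$ (i, j) * eval_quot q \<beta> (h j)) \<longleftrightarrow>
    q dvd (\<Sum>j<dim_col M. M $$ (i, j) * h j)"
proof -
  have sum: "eval_quot q \<beta> (\<Sum>j\<in>S. M $$ (i, j) * h j) =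
      (\<Sum>j\<in>S. eval_quot q \<beta> (M $$ (i, j)) * eval_quot q \<beta> (h j)) mod q" for S :: "nat set"
    by (induction S rule: infinite_finite_induct)
      (auto simp: eval_quot_0 eval_quot_add eval_quot_mult poly_mod_add_left)
  have "(\<Sum>j<dim_col M. component q \<beta> M $$ (i, j) * eval_quot q \<beta> (h j)) =
      (\<Sum>j<dim_col M. eval_quot q \<beta> (M $$ (i, j)) * eval_quot q \<beta> (h j))"
    using assms(3) by (intro sum.cong) (auto simp: component_def)
  then show ?thesis
    using sum[of "{..<dim_col M}"]
      eval_quot_eq_0_iff[OF assms(1,2), of "\<Sum>j<dim_col M. M $$ (i, j) * h j"]
    by (simp add: dvd_eq_mod_eq_0)
qed

lemma mem_mat_ker_mod:
  assumes "v \<in> mat_ker q M" "j < dim_col M"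
  shows "v $ j mod q = v $ j"
  using assms by (simp add: mat_ker_def vecs_def)

lemma dim_col_component [simp]: "dim_col (component q \<beta> M) = dim_col M"
  and dim_row_component [simp]: "dim_row (component q \<beta> M) = dim_row M"
  by (simp_all add: component_def)

text \<open>The automorphism induced by evaluation at \<beta> acts entrywise and matches the kernel
  of \<open>M\<close> modulo \<open>q\<close> with the kernel of the component. Prescribed values
  are transported along it in both directions, so the choice of the root does not matter.\<close>

lemma free_on_component_iff:
  assumes q: "irreducible q" "eval_quot q \<beta> q = 0" and J: "J \<subseteq> {..<dim_col M}"
  shows "free_on q (mat_ker q (component q \<beta> M)) J \<longleftrightarrow> free_on q (mat_ker q M) J"
proof
  assume free: "free_on q (mat_ker q (component q \<beta> M)) J"
  show "free_on q (mat_ker q M) J"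
    unfolding free_on_def
  proof
    fix f :: "nat \<Rightarrow> bit poly"
    obtain c where c: "c \<in> mat_ker q (component q \<beta> M)" "\<forall>i\<in>J. c $ i = eval_quot q \<beta> (f i)"
      using free[unfolded free_on_def, rule_format, of "\<lambda>i. eval_quot q \<beta> (f i)"]
      by (auto simp: eval_quot_mod_self)
    \<comment> \<open>Pulling the component vector back through the automorphism, entry by entry,
      yields a vector that \<open>M\<close> annihilates modulo \<open>q\<close>.\<close>
    have "\<forall>j. \<exists>g. eval_quot q \<beta> g = c $ j mod q" using eval_quot_surj[OF q] by blast
    then obtain h where h: "\<And>j. eval_quot q \<beta> (h j) = c $ j mod q" by metis
    have "q dvd (\<Sum>j<dim_col M. M $$ (i, j) * h j)" if "i < dim_row M" for i
      using c(1) that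
      by (subst dvd_component_sum_iff[OF q that, symmetric]) (simp add: h dvd_sum_mod_iff mat_ker_iff)
    then have "vec (dim_col M) (\<lambda>j. h j mod q) \<in> mat_ker q M" by (simp add: vec_mod_mat_ker_iff)
    moreover have "h i mod q = f i mod q" if "i \<in> J" for i
    proof -
      have "eval_quot q \<beta> (h i) = c $ i mod q" by (rule h)
      also have "\<dots> = eval_quot q \<beta> (f i)" using c(2) that by (simp add: eval_quot_mod_self)
      finally show ?thesis by (simp add: eval_quot_eq_iff[OF q])
    qed
    ultimately show "\<exists>c\<in>mat_ker q M. \<forall>i\<in>J. c $ i = f i mod q"
      using J by (intro bexI[of _ "vec (dim_col M) (\<lambda>j. h j mod q)"]) auto
  qed
next
  assume free: "free_on q (mat_ker q M) J"
  show "free_on q (mat_ker q (component q \<beta> M)) J"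
    unfolding free_on_def
  proof
    fix f :: "nat \<Rightarrow> bit poly"
    have "\<forall>j. \<exists>g. eval_quot q \<beta> g = f j mod q" using eval_quot_surj[OF q] by blast
    then obtain h where h: "\<And>j. eval_quot q \<beta> (h j) = f j mod q" by metis
    obtain c where c: "c \<in> mat_ker q M" "\<forall>i\<in>J. c $ i = h i mod q"
      using free unfolding free_on_def by blast
    define w where "w = vec (dim_col M) (\<lambda>j. eval_quot q \<beta> (c $ j) mod q)"
    have "w \<in> mat_ker q (component q \<beta> M)"
      using c(1) vec_mod_mat_ker_iff[of "component q \<beta> M" "\<lambda>j. eval_quot q \<beta> (c $ j)" q]
      unfolding w_def by (simp add: dvd_component_sum_iff[OF q] mat_ker_iff)
    moreover have "w $ i = f i mod q" if "i \<in> J" for i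
    proof -
      have "w $ i = eval_quot q \<beta> (h i mod q)"
        using that J c(2) by (auto simp: w_def eval_quot_mod_self)
      also have "\<dots> = eval_quot q \<beta> (h i)" by (simp add: eval_quot_eq_iff[OF q])
      finally show ?thesis by (simp add: h)
    qed
    ultimately show "\<exists>c\<in>mat_ker q (component q \<beta> M). \<forall>i\<in>J. c $ i = f i mod q" by blast
  qed
qed

text \<open>Let P be the product of the other factors. The last hypothesis makes \<open>b i\<close>
  coprime to P, so u P + v b_i = 1, and in f = u P f + v b_i f both terms are divisible by P
  b_i.\<close>

lemma prod_irreducible_dvd:
  fixes b :: "'i \<Rightarrow> 'a :: field poly"
  assumes "finite T" "\<And>i. i \<in> T \<Longrightarrow> irreducible (b i)" "\<And>i. i \<in> T \<Longrightarrow> b i dvd f"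
    and "\<And>i. i \<in> T \<Longrightarrow> \<not> b i dvd (\<Prod>j\<in>T - {i}. b j)"
  shows "(\<Prod>i\<in>T. b i) dvd f"
  using assms
proof (induction T rule: finite_induct)
  case (insert i T)
  have "\<not> b j dvd (\<Prod>k\<in>T - {j}. b k)" if "j \<in> T" for j
  proof -
    have "insert i T - {j} = insert i (T - {j})" using that insert.hyps(2) by auto
    then have "(\<Prod>k\<in>insert i T - {j}. b k) = b i * (\<Prod>k\<in>T - {j}. b k)"
      using insert.hyps by simp
    then show ?thesis using insert.prems(3)[of j] that by auto
  qed
  then obtain k where k: "f = (\<Prod>i\<in>T. b i) * k" using insert by (auto elim!: dvdE)
  have "\<not> b i dvd (\<Prod>j\<in>T. b j)" using insert.prems(3)[of i] insert.hyps(2) by simp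
  then obtain u v where uv: "u * (\<Prod>j\<in>T. b j) + v * b i = 1"
    using irreducible_bezout[of "b i"] insert.prems(1) by blast
  obtain m where m: "f = b i * m" using insert.prems(2)[of i] by auto
  have "f = (u * (\<Prod>j\<in>T. b j) + v * b i) * f" using uv by simp
  also have "\<dots> = u * (\<Prod>j\<in>T. b j) * (b i * m) + v * b i * ((\<Prod>i\<in>T. b i) * k)"
    by (subst distrib_right, subst m[symmetric], subst k[symmetric]) simp
  also have "\<dots> = (b i * (\<Prod>j\<in>T. b j)) * (u * m + v * k)" by (simp add: algebra_simps)
  finally show ?case using insert.hyps by simp
qed simp

lemma free_on_dvd:
  assumes "p dvd q" "J \<subseteq> {..<dim_col M}" and free: "free_on q (mat_ker q M) J"
  shows "free_on p (mat_ker p M) J"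
  unfolding free_on_def
proof
  fix f :: "nat \<Rightarrow> bit poly"
  obtain c where c: "c \<in> mat_ker q M" "\<forall>i\<in>J. c $ i = f i mod q"
    using free unfolding free_on_def by blast
  have "vec (dim_col M) (\<lambda>j. c $ j mod p) \<in> mat_ker p M"
    unfolding vec_mod_mat_ker_iff using c(1) dvd_trans[OF assms(1)] by (simp add: mat_ker_iff)
  moreover have "\<forall>i\<in>J. vec (dim_col M) (\<lambda>j. c $ j mod p) $ i = f i mod p"
    using c(2) assms(2) by (auto simp: mod_mod_cancel[OF assms(1)])
  ultimately show "\<exists>c\<in>mat_ker p M. \<forall>i\<in>J. c $ i = f i mod p" by blast
qed

text \<open>The Chinese remainder theorem applied to whole kernel vectors: solutions modulo the
  single factors are glued coordinatewise, which preserves the linear equations.\<close>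

lemma free_on_prod:
  assumes fin: "finite T" and irr: "\<And>i. i \<in> T \<Longrightarrow> irreducible (b i)"
    and sqf: "\<And>i. i \<in> T \<Longrightarrow> \<not> b i dvd (\<Prod>j\<in>T - {i}. b j)"
    and J: "J \<subseteq> {..<dim_col M}" and free: "\<And>i. i \<in> T \<Longrightarrow> free_on (b i) (mat_ker (b i) M) J"
  shows "free_on (\<Prod>i\<in>T. b i) (mat_ker (\<Prod>i\<in>T. b i) M) J"
  unfolding free_on_def
proof
  fix f :: "nat \<Rightarrow> bit poly"
  let ?q = "\<Prod>i\<in>T. b i"
  define Q where "Q i = (\<Prod>j\<in>T - {i}. b j)" for i
  have q: "?q = b i * Q i" if "i \<in> T" for i
    unfolding Q_def by (rule prod.remove[OF fin that])
  have "\<forall>i\<in>T. \<exists>c\<in>mat_ker (b i) M. \<forall>j\<in>J. c $ j = f j mod b i"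
    using free unfolding free_on_def by blast
  then obtain c where c: "\<And>i. i \<in> T \<Longrightarrow> c i \<in> mat_ker (b i) M"
    "\<And>i j. i \<in> T \<Longrightarrow> j \<in> J \<Longrightarrow> c i $ j = f j mod b i" by metis
  have "\<forall>i\<in>T. \<exists>u v. u * Q i + v * b i = 1"
    using irreducible_bezout irr sqf unfolding Q_def by blast
  then obtain u v where uv: "\<And>i. i \<in> T \<Longrightarrow> u i * Q i + v i * b i = 1" by metis
  \<comment> \<open>\<open>u i * Q i\<close> is 1 modulo \<open>b i\<close> and 0 modulo every other
    factor. Moreover \<open>Q i\<close> times a multiple of \<open>b i\<close> is divisible by the
    full product, so every summand satisfies the kernel equations.\<close>
  define g where "g j = (\<Sum>i\<in>T. u i * Q i * c i $ j)" for j
  have "?q dvd (\<Sum>j<dim_col M. M $$ (r, j) * g j)" if r: "r < dim_row M" for r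
  proof -
    have "(\<Sum>j<dim_col M. M $$ (r, j) * g j) =
        (\<Sum>j<dim_col M. \<Sum>i\<in>T. u i * Q i * (M $$ (r, j) * c i $ j))"
      by (simp add: g_def sum_distrib_left mult_ac)
    also have "\<dots> = (\<Sum>i\<in>T. u i * (Q i * (\<Sum>j<dim_col M. M $$ (r, j) * c i $ j)))"
      by (subst sum.swap) (simp add: sum_distrib_left mult_ac)
    also have "?q dvd \<dots>"
    proof (rule dvd_sum, rule dvd_mult)
      fix i assume i: "i \<in> T"
      then show "?q dvd Q i * (\<Sum>j<dim_col M. M $$ (r, j) * c i $ j)"
        using c(1)[OF i] r by (subst q[OF i], subst mult.commute[of "b i"])
          (auto simp: mat_ker_iff intro: mult_dvd_mono)
    qed
    finally show ?thesis .
  qed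
  then have "vec (dim_col M) (\<lambda>j. g j mod ?q) \<in> mat_ker ?q M" by (simp add: vec_mod_mat_ker_iff)
  moreover have "g j mod ?q = f j mod ?q" if j: "j \<in> J" for j
  proof -
    have "b i dvd g j - f j" if i: "i \<in> T" for i
    proof -
      have "g j = u i * Q i * c i $ j + (\<Sum>k\<in>T - {i}. u k * Q k * c k $ j)"
        unfolding g_def by (rule sum.remove[OF fin i])
      also have "u i * Q i = 1 - v i * b i" using uv[OF i] by (metis add_diff_cancel_right')
      finally have eq: "g j - f j = (c i $ j - f j) - b i * (v i * c i $ j) +
          (\<Sum>k\<in>T - {i}. u k * Q k * c k $ j)"
        by (simp add: left_diff_distrib right_diff_distrib mult_ac)
      have "b i dvd c i $ j - f j"
        using c(2)[OF i j] by (simp add: dvd_eq_mod_eq_0 poly_mod_diff_left)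
      moreover have "b i dvd (\<Sum>k\<in>T - {i}. u k * Q k * c k $ j)"
      proof (rule dvd_sum)
        fix k assume "k \<in> T - {i}"
        then have "b i dvd Q k" unfolding Q_def using i fin by (intro dvd_prodI) auto
        then show "b i dvd u k * Q k * c k $ j" by simp
      qed
      ultimately show ?thesis unfolding eq by (intro dvd_add[OF dvd_diff[OF _ dvd_triv_left]])
    qed
    then have "?q dvd g j - f j" by (intro prod_irreducible_dvd fin irr sqf)
    then show ?thesis by (simp add: dvd_eq_mod_eq_0 poly_mod_diff_left)
  qed
  ultimately show "\<exists>c\<in>mat_ker ?q M. \<forall>j\<in>J. c $ j = f j mod ?q"
    using J by (intro bexI[of _ "vec (dim_col M) (\<lambda>j. g j mod ?q)"]) auto
qed

text \<open>Linear combinations of kernel vectors that restrict to unit vectors on \<open>J\<close>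
  realise all values on \<open>J\<close>. This turns a systematic block into freeness.\<close>

lemma free_on_unit_vectors:
  assumes J: "J \<subseteq> {..<dim_col M}"
    and unit: "\<And>j. j \<in> J \<Longrightarrow> \<exists>v\<in>mat_ker q M. \<forall>k\<in>J. v $ k = of_bool (k = j) mod q"
  shows "free_on q (mat_ker q M) J"
  unfolding free_on_def
proof
  fix f :: "nat \<Rightarrow> bit poly"
  have fin: "finite J" using J finite_subset by blast
  obtain v where v: "\<And>j. j \<in> J \<Longrightarrow> v j \<in> mat_ker q M"
    "\<And>j k. j \<in> J \<Longrightarrow> k \<in> J \<Longrightarrow> v j $ k = of_bool (k = j) mod q"
    using unit by metis
  define g where "g k = (\<Sum>j\<in>J. f j * v j $ k)" for k
  have "q dvd (\<Sum>k<dim_col M. M $$ (i, k) * g k)" if "i < dim_row M" for i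
  proof -
    have "(\<Sum>k<dim_col M. M $$ (i, k) * g k) = (\<Sum>k<dim_col M. \<Sum>j\<in>J. f j * (M $$ (i, k) * v j $ k))"
      by (simp add: g_def sum_distrib_left mult_ac)
    also have "\<dots> = (\<Sum>j\<in>J. f j * (\<Sum>k<dim_col M. M $$ (i, k) * v j $ k))"
      by (subst sum.swap) (simp add: sum_distrib_left)
    also have "q dvd \<dots>"
    proof (rule dvd_sum, rule dvd_mult)
      fix j assume "j \<in> J"
      then show "q dvd (\<Sum>k<dim_col M. M $$ (i, k) * v j $ k)" using v(1) that by (simp add: mat_ker_iff)
    qed
    finally show ?thesis .
  qed
  then have "vec (dim_col M) (\<lambda>k. g k mod q) \<in> mat_ker q M" by (simp add: vec_mod_mat_ker_iff)
  moreover have "g k mod q = f k mod q" if k: "k \<in> J" for k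
  proof -
    have "g k mod q = (\<Sum>j\<in>J. f j * of_bool (k = j)) mod q"
      unfolding g_def by (subst (1 2) mod_sum_eq[symmetric])
        (use v(2) k in \<open>simp add: mod_mult_right_eq\<close>)
    also have "(\<Sum>j\<in>J. f j * of_bool (k = j)) = f k"
      using fin k by (simp add: of_bool_def if_distrib sum.delta cong: if_cong)
    finally show ?thesis .
  qed
  ultimately show "\<exists>c\<in>mat_ker q M. \<forall>k\<in>J. c $ k = f k mod q"
    using J by (intro bexI[of _ "vec (dim_col M) (\<lambda>k. g k mod q)"]) auto
qed

text \<open>A repeated factor also divides the derivative, which is x^(l-1) because \<open>l\<close>
  is odd. It then divides both x^l and x^l + 1, hence 1.\<close>

lemma square_not_dvd_cyc:
  assumes "odd l" "b * b dvd cyc l"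
  shows "b dvd 1"
proof -
  obtain k where k: "cyc l = b * b * k" using assms(2) by (auto elim: dvdE)
  then have "pderiv (cyc l) = b * (pderiv b * k + pderiv b * k + b * pderiv k)"
    by (simp add: pderiv_mult algebra_simps)
  moreover have "(of_nat l :: bit) = 1" using assms(1) by (auto elim!: oddE)
  then have "pderiv (cyc l) = monom 1 (l - 1)"
    by (simp add: cyc_def pderiv_add pderiv_monom)
  ultimately have "b dvd monom 1 (l - 1)" by (metis dvd_triv_left)
  then have "b dvd monom 1 1 * monom 1 (l - 1)" by (rule dvd_mult)
  also have "monom 1 1 * monom 1 (l - 1) = (monom 1 l :: bit poly)"
    using assms(1) by (cases l) (auto simp: mult_monom)
  finally have "b dvd monom 1 l" .
  moreover have "b dvd cyc l" unfolding k by simp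
  ultimately show ?thesis by (simp add: cyc_def dvd_add_right_iff)
qed

text \<open>Trades the simultaneous choice of information sets over the component fields for one
  free set over R. In the converse direction each component extends the same \<open>J\<close>
  independently of the others.\<close>

lemma information_sets_iff_free_on_cyc:
  assumes l: "odd l" and cyc: "cyc l = (\<Prod>i\<in>T. b i)" and fin: "finite T"
    and irr: "\<And>i. i \<in> T \<Longrightarrow> irreducible (b i)"
    and root: "\<And>i. i \<in> T \<Longrightarrow> eval_quot (b i) (\<beta> i) (b i) = 0"
  shows "(\<exists>I. (\<forall>i\<in>T. information_set (b i) (dim_col M) (mat_ker (b i) (component (b i) (\<beta> i) M)) (I i)) \<and>
            r \<le> card (\<Inter>i\<in>T. I i)) \<longleftrightarrow>
    (\<exists>J\<subseteq>{..<dim_col M}. card J = r \<and> free_on (cyc l) (mat_ker (cyc l) M) J)"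
proof -
  \<comment> \<open>With no index the intersection below would be all of \<open>nat\<close>, neither
    finite nor contained in the coordinate range.\<close>
  have "T \<noteq> {}"
  proof
    assume "T = {}"
    then have "monom 1 l = (0 :: bit poly)" using cyc by (simp add: cyc_def)
    then show False by simp
  qed
  then obtain i\<^sub>0 where i\<^sub>0: "i\<^sub>0 \<in> T" by blast
  have sqf: "\<not> b i dvd (\<Prod>j\<in>T - {i}. b j)" if i: "i \<in> T" for i
  proof
    assume "b i dvd (\<Prod>j\<in>T - {i}. b j)"
    then have "b i * b i dvd cyc l" unfolding cyc prod.remove[OF fin i] by (rule mult_dvd_mono[OF dvd_refl])
    then have "b i dvd 1" by (rule square_not_dvd_cyc[OF l])
    then show False using irreducible_not_unit[OF irr[OF i]] by contradiction
  qed
  show ?thesis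
  proof safe
    fix I assume I: "\<forall>i\<in>T. information_set (b i) (dim_col M) (mat_ker (b i) (component (b i) (\<beta> i) M)) (I i)"
      and r: "r \<le> card (\<Inter>i\<in>T. I i)"
    \<comment> \<open>The intersection may be larger than \<open>r\<close>, but subsets of free sets
      are free, so it can be cut down to size exactly \<open>r\<close>.\<close>
    obtain J where J: "J \<subseteq> (\<Inter>i\<in>T. I i)" "card J = r"
      using r obtain_subset_with_card_n by metis
    have sub: "I i \<subseteq> {..<dim_col M}" if "i \<in> T" for i
      using I that by (simp add: information_set_def)
    then have Jn: "J \<subseteq> {..<dim_col M}" using J(1) i\<^sub>0 by blast
    have "free_on (b i) (mat_ker (b i) M) J" if i: "i \<in> T" for i
    proof -
      have "free_on (b i) (mat_ker (b i) (component (b i) (\<beta> i) M)) (I i)"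
        using information_set_iff[OF irr[OF i], of "I i" "component (b i) (\<beta> i) M"] I i sub[OF i]
        by simp
      then have "free_on (b i) (mat_ker (b i) (component (b i) (\<beta> i) M)) J"
        by (rule free_on_subset) (use J(1) i in blast)
      then show ?thesis using free_on_component_iff[OF irr[OF i] root[OF i] Jn] by simp
    qed
    then have "free_on (cyc l) (mat_ker (cyc l) M) J"
      unfolding cyc by (intro free_on_prod fin irr sqf Jn)
    then show "\<exists>J\<subseteq>{..<dim_col M}. card J = r \<and> free_on (cyc l) (mat_ker (cyc l) M) J"
      using J(2) Jn by blast
  next
    fix J assume J: "J \<subseteq> {..<dim_col M}" and free: "free_on (cyc l) (mat_ker (cyc l) M) J"
      and r: "r = card J"
    have "\<exists>I. J \<subseteq> I \<and> information_set (b i) (dim_col M) (mat_ker (b i) (component (b i) (\<beta> i) M)) I"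
      if i: "i \<in> T" for i
    proof -
      have "b i dvd cyc l" unfolding cyc using fin i by (rule dvd_prodI)
      then have "free_on (b i) (mat_ker (b i) (component (b i) (\<beta> i) M)) J"
        using free_on_dvd[OF _ J free] free_on_component_iff[OF irr[OF i] root[OF i] J] by simp
      then show ?thesis using free_on_extend[OF irr[OF i], of J "component (b i) (\<beta> i) M"] J by simp
    qed
    then obtain I where I: "\<And>i. i \<in> T \<Longrightarrow> J \<subseteq> I i"
      "\<And>i. i \<in> T \<Longrightarrow> information_set (b i) (dim_col M) (mat_ker (b i) (component (b i) (\<beta> i) M)) (I i)"
      by metis
    have "finite (\<Inter>i\<in>T. I i)"
      using I(2)[OF i\<^sub>0] i\<^sub>0 by (auto simp: information_set_def intro: finite_subset)
    then have "card J \<le> card (\<Inter>i\<in>T. I i)" using I(1) by (intro card_mono) auto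
    then show "\<exists>I. (\<forall>i\<in>T. information_set (b i) (dim_col M)
        (mat_ker (b i) (component (b i) (\<beta> i) M)) (I i)) \<and> card J \<le> card (\<Inter>i\<in>T. I i)"
      using I(2) by blast
  qed
qed

section \<open>Independent homology classes\<close>

lemma disjoint_mono: "A' \<subseteq> A \<Longrightarrow> B' \<subseteq> B \<Longrightarrow> A \<inter> B = {} \<Longrightarrow> A' \<inter> B' = {}"
  by blast

text \<open>Applying the functional of \<open>s\<close> to a vanishing linear combination leaves
  only the coefficient of \<open>s\<close>.\<close>

lemma (in vectorspace) lin_indpt_dual:
  assumes S: "finite S" "S \<subseteq> carrier V"
    and f: "\<And>s x. s \<in> S \<Longrightarrow> x \<in> carrier V \<Longrightarrow> f s x \<in> carrier K"
    and add: "\<And>s x y. s \<in> S \<Longrightarrow> x \<in> carrier V \<Longrightarrow> y \<in> carrier V \<Longrightarrow> f s (x \<oplus>\<^bsub>V\<^esub> y) = f s x \<oplus>\<^bsub>K\<^esub> f s y"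
    and smult: "\<And>s c x. s \<in> S \<Longrightarrow> c \<in> carrier K \<Longrightarrow> x \<in> carrier V \<Longrightarrow> f s (c \<odot>\<^bsub>V\<^esub> x) = c \<otimes>\<^bsub>K\<^esub> f s x"
    and dual: "\<And>s t. s \<in> S \<Longrightarrow> t \<in> S \<Longrightarrow> f s t = (if s = t then \<one>\<^bsub>K\<^esub> else \<zero>\<^bsub>K\<^esub>)"
  shows "lin_indpt S"
proof (rule finite_lin_indpt2[OF S], rule ballI)
  fix a s assume a: "a \<in> S \<rightarrow> carrier K" and zero: "lincomb a S = \<zero>\<^bsub>V\<^esub>" and s: "s \<in> S"
  have f0: "f s \<zero>\<^bsub>V\<^esub> = \<zero>\<^bsub>K\<^esub>"
    using smult[OF s, of "\<zero>\<^bsub>K\<^esub>" "\<zero>\<^bsub>V\<^esub>"] f[OF s, of "\<zero>\<^bsub>V\<^esub>"] by simp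
  have "finite T \<Longrightarrow> T \<subseteq> S \<Longrightarrow> f s (lincomb a T) = (if s \<in> T then a s else \<zero>\<^bsub>K\<^esub>)" for T
  proof (induction T rule: finite_induct)
    case empty
    then show ?case by (simp add: f0)
  next
    case (insert t T)
    have t: "t \<in> carrier V" "a t \<in> carrier K" and T: "T \<subseteq> carrier V" "a \<in> T \<rightarrow> carrier K"
      using insert.prems S a by auto
    have "lincomb a (insert t T) = a t \<odot>\<^bsub>V\<^esub> t \<oplus>\<^bsub>V\<^esub> lincomb a T"
      using lincomb_insert[of T a t] insert.hyps t T by auto
    moreover have "lincomb a T \<in> carrier V" using T by (intro lincomb_closed) auto
    moreover have "a s \<in> carrier K" using a s by auto
    ultimately show ?case
      using insert t s by (auto simp: add smult dual f)
  qed
  from this[OF S(1)] show "a s = \<zero>\<^bsub>K\<^esub>" using zero s f0 by simp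
qed

lemma (in vectorspace) lin_indpt_extend:
  assumes fin: "finite (carrier V)" and S: "S \<subseteq> carrier V" "lin_indpt S"
  shows "\<exists>T. S \<subseteq> T \<and> basis T"
proof -
  let ?P = "\<lambda>T. S \<subseteq> T \<and> T \<subseteq> carrier V \<and> lin_indpt T"
  have "\<exists>T. finite T \<and> maximal T ?P"
  proof (rule maximal_exists)
    show "?P S" using S by simp
  qed (use fin in \<open>auto intro: finite_subset card_mono\<close>)
  then obtain T where "maximal T ?P" by blast
  then have "maximal T (\<lambda>T. T \<subseteq> carrier V \<and> lin_indpt T)" and "S \<subseteq> T"
    unfolding maximal_def by (meson subset_trans)+
  then show ?thesis using max_li_is_basis by blast
qed

section \<open>Conjugation on R and adjoint matrices\<close>

lemma degree_cyc: "0 < l \<Longrightarrow> degree (cyc l) = l"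
  by (simp add: cyc_def degree_add_eq_left degree_monom_eq)

lemma monom_mod_cyc:
  assumes "m < l"
  shows "monom 1 m mod cyc l = monom 1 m"
proof -
  have "degree (cyc l) = l" using assms by (intro degree_cyc) simp
  then show ?thesis using assms by (intro mod_poly_less) (simp add: degree_monom_eq)
qed

lemma cyc_neq_0: "0 < l \<Longrightarrow> cyc l \<noteq> 0"
  using degree_cyc[of l] by auto

lemma mod_mult_cong:
  fixes a a' b b' q :: "'a :: euclidean_semiring_cancel"
  assumes "a mod q = a' mod q" "b mod q = b' mod q"
  shows "(a * b) mod q = (a' * b') mod q"
proof -
  have "(a * b) mod q = ((a mod q) * (b mod q)) mod q" by (rule mod_mult_eq[symmetric])
  also have "\<dots> = (a' * b') mod q" unfolding assms by (rule mod_mult_eq)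
  finally show ?thesis .
qed

lemma pcompose_mod_cong:
  fixes f g h q :: "bit poly"
  assumes "g mod q = h mod q"
  shows "pcompose f g mod q = pcompose f h mod q"
proof (induction f rule: pCons_induct)
  case (pCons a f)
  have "(g * pcompose f g) mod q = (h * pcompose f h) mod q"
    using assms pCons.IH by (rule mod_mult_cong)
  then show ?case by (simp add: pcompose_pCons poly_mod_add_left)
qed simp

lemma monom_pow_mod_cyc: "monom 1 (l * k) mod cyc l = 1 mod cyc l"
proof -
  have "monom 1 l mod cyc l = 1 mod cyc l"
  proof -
    have "monom 1 l - 1 = cyc l - 2" by (simp add: cyc_def)
    then have "cyc l dvd monom 1 l - 1" by (simp add: two_bit_poly)
    then show ?thesis by (simp add: dvd_eq_mod_eq_0 poly_mod_diff_left)
  qed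
  then have "(monom 1 l mod cyc l) ^ k mod cyc l = (1 mod cyc l) ^ k mod cyc l" by (rule arg_cong)
  then have "monom 1 l ^ k mod cyc l = 1 ^ k mod cyc l" unfolding power_mod .
  then show ?thesis by (simp add: monom_power)
qed

lemma pcompose_monom_monom: "pcompose (monom 1 a) (monom 1 b) = (monom 1 (b * a) :: bit poly)"
  by (induction a) (simp_all add: monom_Suc pcompose_pCons mult_monom pcompose_1)

lemma conj_R_0 [simp]: "conj_R l 0 = 0"
  by (simp add: conj_R_def)

lemma conj_R_1: "conj_R l 1 = 1 mod cyc l"
  by (simp add: conj_R_def pcompose_1)

lemma conj_R_mod_self [simp]: "conj_R l f mod cyc l = conj_R l f"
  by (simp add: conj_R_def)

lemma conj_R_add: "conj_R l (f + g) = conj_R l f + conj_R l g"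
  by (simp add: conj_R_def pcompose_add poly_mod_add_left)

lemma conj_R_mult: "conj_R l (f * g) = (conj_R l f * conj_R l g) mod cyc l"
  by (simp add: conj_R_def pcompose_mult mod_mult_eq)

lemma conj_R_sum_mult: "conj_R l (\<Sum>i\<in>S. f i * g i) = (\<Sum>i\<in>S. conj_R l (f i) * conj_R l (g i)) mod cyc l"
  by (induction S rule: infinite_finite_induct) (auto simp: conj_R_add conj_R_mult poly_mod_add_left)

text \<open>This is what makes conjugation well defined on residue classes: substituting x^(l-1)
  into x^l + 1 gives x^(l(l-1)) + 1, which is 1 + 1 = 0 in R.\<close>

lemma conj_R_cyc:
  assumes "0 < l"
  shows "conj_R l (cyc l) = 0"
proof -
  have "pcompose (cyc l) (monom 1 (l - 1)) = monom 1 (l * (l - 1)) + 1"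
    by (simp add: cyc_def pcompose_add pcompose_monom_monom pcompose_1 mult.commute)
  then have "conj_R l (cyc l) = monom 1 (l * (l - 1)) mod cyc l + 1 mod cyc l"
    by (simp add: conj_R_def poly_mod_add_left)
  also have "\<dots> = (1 + 1) mod cyc l" unfolding monom_pow_mod_cyc by (rule poly_mod_add_left[symmetric])
  also have "\<dots> = 0" by (simp add: two_bit_poly)
  finally show ?thesis .
qed

lemma conj_R_mod:
  assumes "0 < l"
  shows "conj_R l (f mod cyc l) = conj_R l f"
proof -
  have "conj_R l f = conj_R l (f div cyc l * cyc l + f mod cyc l)" by simp
  also have "\<dots> = conj_R l (f mod cyc l)"
    by (simp only: conj_R_add conj_R_mult conj_R_cyc[OF assms]) simp
  finally show ?thesis by simp
qed

lemma conj_R_dvd: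
  assumes "0 < l" "cyc l dvd f"
  shows "conj_R l f = 0"
  using conj_R_mod[OF assms(1), of f] assms(2) by (simp add: dvd_eq_mod_eq_0)

text \<open>Conjugating twice substitutes x raised to (l-1)^2, and (l-1)^2 = l (l-2) + 1 is
  congruent to 1 modulo \<open>l\<close>.\<close>

lemma conj_R_conj_R:
  assumes "0 < l"
  shows "conj_R l (conj_R l f) = f mod cyc l"
proof -
  have "monom 1 ((l - 1) * (l - 1)) mod cyc l = monom 1 1 mod cyc l"
  \<comment> \<open>The factor l - 2 is not a natural number for \<open>l = 1\<close>; there x is
    congruent to 1 and both monomials reduce to 1.\<close>
  proof (cases "l = 1")
    case True
    then show ?thesis using monom_pow_mod_cyc[of 1 1] by simp
  next
    case False
    then obtain k where k: "l = Suc (Suc k)" using assms by (metis One_nat_def not0_implies_Suc not_gr0)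
    have "(l - 1) * (l - 1) = l * k + 1" by (simp add: k)
    then have "monom 1 ((l - 1) * (l - 1)) = monom 1 (l * k) * (monom 1 1 :: bit poly)"
      by (simp add: mult_monom)
    also have "\<dots> mod cyc l = (1 * monom 1 1) mod cyc l"
      by (rule mod_mult_cong[OF monom_pow_mod_cyc refl])
    finally show ?thesis by simp
  qed
  then have "pcompose f (monom 1 ((l - 1) * (l - 1))) mod cyc l = pcompose f (monom 1 1) mod cyc l"
    by (rule pcompose_mod_cong)
  moreover have "pcompose f (monom 1 1) = f"
    by (simp add: monom_altdef pcompose_idR)
  moreover have "pcompose f (monom 1 ((l - 1) * (l - 1))) = pcompose (pcompose f (monom 1 (l - 1))) (monom 1 (l - 1))"
    by (simp add: pcompose_assoc[symmetric] pcompose_monom_monom)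
  moreover have "conj_R l (conj_R l f) = pcompose (pcompose f (monom 1 (l - 1))) (monom 1 (l - 1)) mod cyc l"
    using conj_R_mod[OF assms, of "pcompose f (monom 1 (l - 1))"] by (simp add: conj_R_def)
  ultimately show ?thesis by simp
qed

lemma dim_adj_mat [simp]: "dim_row (adj_mat l D) = dim_col D" "dim_col (adj_mat l D) = dim_row D"
  by (simp_all add: adj_mat_def)

lemma index_adj_mat [simp]:
  "i < dim_col D \<Longrightarrow> j < dim_row D \<Longrightarrow> adj_mat l D $$ (i, j) = conj_R l (D $$ (j, i))"
  by (simp add: adj_mat_def)

lemma index_mat_app:
  assumes "y \<in> carrier_vec (dim_col D)" "i < dim_row D"
  shows "mat_app q D y $ i = (\<Sum>j<dim_col D. D $$ (i, j) * y $ j) mod q"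
  using assms by (simp add: mat_app_def reduce_vec_def scalar_prod_def lessThan_atLeast0)

lemma sum_mod_mult_dvd_iff:
  fixes q :: "bit poly"
  assumes "\<And>i. i \<in> S \<Longrightarrow> f i mod q = f' i mod q"
  shows "q dvd (\<Sum>i\<in>S. f i * g i) \<longleftrightarrow> q dvd (\<Sum>i\<in>S. f' i * g i)"
proof -
  have "(f i * g i) mod q = (f' i * g i) mod q" if "i \<in> S" for i
    by (rule mod_mult_cong[OF assms[OF that] refl])
  then have "(\<Sum>i\<in>S. f i * g i) mod q = (\<Sum>i\<in>S. f' i * g i) mod q"
    by (subst (1 2) mod_sum_eq[symmetric]) simp
  then show ?thesis by (simp add: dvd_eq_mod_eq_0)
qed

text \<open>The double adjoint merely reduces the entries modulo x^l + 1: the matrices may differ,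
  but the kernels do not. Needed when homology and cohomology exchange roles.\<close>

lemma mat_ker_adj_adj:
  assumes "0 < l"
  shows "mat_ker (cyc l) (adj_mat l (adj_mat l D)) = mat_ker (cyc l) D"
proof (rule Set.set_eqI)
  fix w
  have "cyc l dvd (\<Sum>j<dim_col D. adj_mat l (adj_mat l D) $$ (i, j) * w $ j) \<longleftrightarrow>
      cyc l dvd (\<Sum>j<dim_col D. D $$ (i, j) * w $ j)" if "i < dim_row D" for i
    using that by (intro sum_mod_mult_dvd_iff) (simp add: conj_R_conj_R[OF assms])
  then show "w \<in> mat_ker (cyc l) (adj_mat l (adj_mat l D)) \<longleftrightarrow> w \<in> mat_ker (cyc l) D"
    by (simp add: mat_ker_iff)
qed

text \<open>The adjunction <D y, w> = <y, D' w>, where D' is \<open>adj_mat l D\<close>: boundaries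
  pair to zero with cocycles.\<close>

lemma mat_im_orthogonal:
  assumes l: "0 < l" and z: "z \<in> mat_im (cyc l) D" and w: "w \<in> mat_ker (cyc l) (adj_mat l D)"
  shows "cyc l dvd (\<Sum>i<dim_row D. z $ i * conj_R l (w $ i))"
proof -
  obtain y where y: "y \<in> vecs (cyc l) (dim_col D)" "z = mat_app (cyc l) D y"
    using z by (auto simp: mat_im_def)
  have "cyc l dvd (\<Sum>i<dim_row D. D $$ (i, c) * conj_R l (w $ i))" if c: "c < dim_col D" for c
  proof -
    have "cyc l dvd (\<Sum>i<dim_row D. adj_mat l D $$ (c, i) * w $ i)"
      using w c by (simp add: mat_ker_iff)
    \<comment> \<open>Conjugating the kernel equation turns the entries of the adjoint back into
      those of \<open>D\<close>, by involutivity.\<close>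
    then have "conj_R l (\<Sum>i<dim_row D. adj_mat l D $$ (c, i) * w $ i) = 0" by (rule conj_R_dvd[OF l])
    then have "cyc l dvd (\<Sum>i<dim_row D. conj_R l (adj_mat l D $$ (c, i)) * conj_R l (w $ i))"
      unfolding conj_R_sum_mult by (rule mod_0_imp_dvd)
    then show ?thesis
      using sum_mod_mult_dvd_iff[of "{..<dim_row D}" "\<lambda>i. conj_R l (adj_mat l D $$ (c, i))" "cyc l"
          "\<lambda>i. D $$ (i, c)"] c by (simp add: conj_R_conj_R[OF l])
  qed
  then have "cyc l dvd (\<Sum>c<dim_col D. y $ c * (\<Sum>i<dim_row D. D $$ (i, c) * conj_R l (w $ i)))"
    by (rule dvd_sum[OF dvd_mult]) simp
  also have "\<dots> = (\<Sum>i<dim_row D. (\<Sum>c<dim_col D. D $$ (i, c) * y $ c) * conj_R l (w $ i))"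
    by (simp add: sum_distrib_left sum_distrib_right mult_ac) (rule sum.swap)
  finally show ?thesis
    using sum_mod_mult_dvd_iff[of "{..<dim_row D}" "\<lambda>i. z $ i" "cyc l"
        "\<lambda>i. \<Sum>c<dim_col D. D $$ (i, c) * y $ c"] y
    by (simp add: index_mat_app vecs_def)
qed

section \<open>Homology as a space over F_2 and the functionals given by the pairing\<close>

lemma bin_smult:
  fixes v :: "bit poly vec"
  shows "map_vec (Polynomial.smult c) v = (if c = 0 then 0\<^sub>v (dim_vec v) else v)"
  by (cases "c = 0") (auto intro!: eq_vecI)

lemma zero_mat_ker: "0\<^sub>v (dim_col D) \<in> mat_ker q D"
  by (simp add: mat_ker_iff zero_vecs)

lemma add_mat_ker: "u \<in> mat_ker q D \<Longrightarrow> v \<in> mat_ker q D \<Longrightarrow> u + v \<in> mat_ker q D"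
  using add_vecs[of u q "dim_col D" v] mat_app_add[of u D v q] by (auto simp: mat_ker_def vecs_def)

lemma vectorspace_cycles: "vectorspace class_ring (cycles l D)"
proof -
  have "submodule class_ring (mat_ker (cyc l) D) (bin_space l (dim_col D))"
  proof (rule submodule.intro)
    show "module class_ring (bin_space l (dim_col D))"
      using vectorspace_bin_space by (rule vectorspace.axioms)
  next
    fix c :: bit and v assume v: "v \<in> mat_ker (cyc l) D"
    then have "dim_vec v = dim_col D" by (simp add: mat_ker_def vecs_def)
    then show "c \<odot>\<^bsub>bin_space l (dim_col D)\<^esub> v \<in> mat_ker (cyc l) D"
      using v by (simp add: bin_space_def bin_smult zero_mat_ker)
  qed (auto simp: bin_space_def add_mat_ker zero_mat_ker, auto simp: mat_ker_def)
  then have "subspace class_ring (mat_ker (cyc l) D) (bin_space l (dim_col D))"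
    using vectorspace_bin_space by (simp add: subspace_def)
  then show ?thesis
    unfolding cycles_def using vectorspace.subspace_is_vs[OF vectorspace_bin_space] by blast
qed

locale chain_complex =
  fixes l :: nat and D1 D2 :: "bit poly mat"
  assumes l_pos: "0 < l" and mat_im_subset: "mat_im (cyc l) D2 \<subseteq> mat_ker (cyc l) D1"
begin

lemma zero_mat_im: "0\<^sub>v (dim_row D2) \<in> mat_im (cyc l) D2"
  unfolding mat_im_def
  by (rule image_eqI[of _ _ "0\<^sub>v (dim_col D2)"]) (auto simp: mat_app_def reduce_vec_def zero_vecs)

text \<open>The zero vector of the image has length \<open>dim_row D2\<close>; as an element of the
  kernel it also has length \<open>dim_col D1\<close>.\<close>

lemma dims: "dim_row D2 = dim_col D1"
proof -
  have "0\<^sub>v (dim_row D2) \<in> mat_ker (cyc l) D1" using zero_mat_im mat_im_subset by blast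
  then have "(0\<^sub>v (dim_row D2) :: bit poly vec) \<in> carrier_vec (dim_col D1)"
    by (simp add: mat_ker_def vecs_def)
  then show ?thesis using carrier_vecD by fastforce
qed

lemma cycles_simps [simp]:
  "carrier (cycles l D1) = mat_ker (cyc l) D1" "x \<oplus>\<^bsub>cycles l D1\<^esub> y = x + y"
  "\<zero>\<^bsub>cycles l D1\<^esub> = 0\<^sub>v (dim_col D1)" "c \<odot>\<^bsub>cycles l D1\<^esub> x = map_vec (Polynomial.smult c) x"
  by (simp_all add: cycles_def bin_space_def)

lemma subspace_mat_im: "subspace class_ring (mat_im (cyc l) D2) (cycles l D1)"
proof -
  have "submodule class_ring (mat_im (cyc l) D2) (cycles l D1)"
  proof (rule submodule.intro)
    show "module class_ring (cycles l D1)" using vectorspace_cycles by (rule vectorspace.axioms)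
  next
    fix u v assume uv: "u \<in> mat_im (cyc l) D2" "v \<in> mat_im (cyc l) D2"
    then obtain x y where "x \<in> vecs (cyc l) (dim_col D2)" "y \<in> vecs (cyc l) (dim_col D2)"
      "u = mat_app (cyc l) D2 x" "v = mat_app (cyc l) D2 y" by (auto simp: mat_im_def)
    then have "u + v = mat_app (cyc l) D2 (x + y)" "x + y \<in> vecs (cyc l) (dim_col D2)"
      by (auto simp: mat_app_add add_vecs) (auto simp: vecs_def mat_app_add)
    then show "u \<oplus>\<^bsub>cycles l D1\<^esub> v \<in> mat_im (cyc l) D2" by (simp add: mat_im_def)
  next
    fix c :: bit and v assume v: "v \<in> mat_im (cyc l) D2"
    then have "dim_vec v = dim_row D2" by (auto simp: mat_im_def mat_app_def reduce_vec_def)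
    then show "c \<odot>\<^bsub>cycles l D1\<^esub> v \<in> mat_im (cyc l) D2"
      using v zero_mat_im by (simp add: bin_smult)
  qed (use mat_im_subset zero_mat_im in \<open>auto simp: dims\<close>)
  then show ?thesis using vectorspace_cycles by (simp add: subspace_def)
qed

sublocale H: vectorspace class_ring "homology l D1 D2"
  unfolding homology_def by (rule vectorspace_quot_space[OF subspace_mat_im])

lemma hom_class_eq: "hom_class l D1 D2 v = {z + v | z. z \<in> mat_im (cyc l) D2}"
  unfolding hom_class_def a_r_coset_def' by auto

lemma carrier_homology: "carrier (homology l D1 D2) = hom_class l D1 D2 ` mat_ker (cyc l) D1"
proof -
  have "a_rcosets\<^bsub>cycles l D1\<^esub> W = (\<lambda>v. W +>\<^bsub>cycles l D1\<^esub> v) ` mat_ker (cyc l) D1" for W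
    unfolding A_RCOSETS_def' by auto
  then show ?thesis by (simp add: homology_def quot_space_def hom_class_def[abs_def])
qed

lemma finite_homology: "finite (carrier (homology l D1 D2))"
proof -
  have "mat_ker (cyc l) D1 \<subseteq> vecs (cyc l) (dim_col D1)" by (auto simp: mat_ker_def)
  then have "finite (mat_ker (cyc l) D1)"
    using finite_vecs[OF cyc_neq_0[OF l_pos]] by (rule finite_subset)
  then show ?thesis by (simp add: carrier_homology)
qed

lemma hom_class_self:
  assumes "v \<in> mat_ker (cyc l) D1"
  shows "v \<in> hom_class l D1 D2 v"
proof -
  have "v \<in> carrier_vec (dim_col D1)" using assms by (simp add: mat_ker_def vecs_def)
  then have "v = 0\<^sub>v (dim_col D1) + v" by simp
  then show ?thesis using zero_mat_im unfolding hom_class_eq dims by blast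
qed

text \<open>One coefficient of the sesquilinear pairing of \<open>v\<close> with \<open>w\<close>.
  Each \<open>w\<close> thus gives l functionals that are linear over F_2, as required by the
  scalars of \<open>homology\<close>.\<close>

definition pair_coeff :: "bit poly vec \<Rightarrow> nat \<Rightarrow> bit poly vec \<Rightarrow> bit" where
  "pair_coeff w m v = coeff ((\<Sum>i<dim_col D1. v $ i * conj_R l (w $ i)) mod cyc l) m"

lemma pair_coeff_add:
  assumes "u \<in> carrier_vec (dim_col D1)" "v \<in> carrier_vec (dim_col D1)"
  shows "pair_coeff w m (u + v) = pair_coeff w m u + pair_coeff w m v"
proof -
  have "(\<Sum>i<dim_col D1. (u + v) $ i * conj_R l (w $ i)) =
      (\<Sum>i<dim_col D1. u $ i * conj_R l (w $ i)) + (\<Sum>i<dim_col D1. v $ i * conj_R l (w $ i))"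
    unfolding sum.distrib[symmetric] using assms by (intro sum.cong) (auto simp: distrib_right)
  then show ?thesis by (simp only: pair_coeff_def poly_mod_add_left coeff_add)
qed

lemma pair_coeff_zero: "pair_coeff w m (0\<^sub>v (dim_col D1)) = 0"
  by (simp add: pair_coeff_def)

lemma pair_coeff_mat_im:
  assumes "z \<in> mat_im (cyc l) D2" "w \<in> mat_ker (cyc l) (adj_mat l D2)"
  shows "pair_coeff w m z = 0"
  using mat_im_orthogonal[OF l_pos assms] by (simp add: pair_coeff_def dims dvd_eq_mod_eq_0)

lemma pair_coeff_hom_class:
  assumes w: "w \<in> mat_ker (cyc l) (adj_mat l D2)" and v: "v \<in> mat_ker (cyc l) D1"
    and x: "x \<in> hom_class l D1 D2 v"
  shows "pair_coeff w m x = pair_coeff w m v"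
proof -
  obtain z where z: "z \<in> mat_im (cyc l) D2" "x = z + v" using x by (auto simp: hom_class_eq)
  moreover have "z \<in> carrier_vec (dim_col D1)" "v \<in> carrier_vec (dim_col D1)"
    using z(1) v mat_im_subset by (auto simp: mat_ker_def vecs_def)
  ultimately show ?thesis using w by (simp add: pair_coeff_add pair_coeff_mat_im)
qed

text \<open>The representative is arbitrary; independence of it holds when \<open>w\<close> is a
  cocycle, because the pairing then vanishes on boundaries.\<close>

definition class_coeff :: "bit poly vec \<Rightarrow> nat \<Rightarrow> bit poly vec set \<Rightarrow> bit" where
  "class_coeff w m X = pair_coeff w m (SOME x. x \<in> X)"

lemma class_coeff_eq:
  assumes w: "w \<in> mat_ker (cyc l) (adj_mat l D2)" and X: "X \<in> carrier (homology l D1 D2)"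
    and x: "x \<in> X"
  shows "class_coeff w m X = pair_coeff w m x"
proof -
  obtain v where v: "v \<in> mat_ker (cyc l) D1" "X = hom_class l D1 D2 v"
    using X by (auto simp: carrier_homology)
  have "(SOME x. x \<in> X) \<in> X" using x by (rule someI)
  then show ?thesis
    using pair_coeff_hom_class[OF w v(1)] x unfolding class_coeff_def v(2) by simp
qed

lemma carrier_homology_rep:
  assumes "X \<in> carrier (homology l D1 D2)"
  shows "\<exists>x\<in>X. x \<in> carrier_vec (dim_col D1)"
proof -
  obtain v where v: "v \<in> mat_ker (cyc l) D1" "X = hom_class l D1 D2 v"
    using assms unfolding carrier_homology by blast
  have "v \<in> carrier_vec (dim_col D1)" using v(1) by (simp add: mat_ker_def vecs_def)
  then show ?thesis using hom_class_self[OF v(1)] v(2) by blast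
qed

lemma class_coeff_add:
  assumes w: "w \<in> mat_ker (cyc l) (adj_mat l D2)" and X: "X \<in> carrier (homology l D1 D2)"
    and Y: "Y \<in> carrier (homology l D1 D2)"
  shows "class_coeff w m (X \<oplus>\<^bsub>homology l D1 D2\<^esub> Y) = class_coeff w m X + class_coeff w m Y"
proof -
  obtain x y where xy: "x \<in> X" "y \<in> Y" "x \<in> carrier_vec (dim_col D1)" "y \<in> carrier_vec (dim_col D1)"
    using carrier_homology_rep X Y by blast
  have "X \<oplus>\<^bsub>homology l D1 D2\<^esub> Y = (\<Union>x\<in>X. \<Union>y\<in>Y. {x + y})"
    by (simp add: homology_def quot_space_def set_add_def')
  then have "x + y \<in> X \<oplus>\<^bsub>homology l D1 D2\<^esub> Y" using xy(1,2) by blast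
  then have "class_coeff w m (X \<oplus>\<^bsub>homology l D1 D2\<^esub> Y) = pair_coeff w m (x + y)"
    by (rule class_coeff_eq[OF w H.a_closed[OF X Y]])
  also have "\<dots> = pair_coeff w m x + pair_coeff w m y" by (rule pair_coeff_add[OF xy(3,4)])
  finally show ?thesis
    unfolding class_coeff_eq[OF w X xy(1)] class_coeff_eq[OF w Y xy(2)] .
qed

lemma class_coeff_smult:
  assumes w: "w \<in> mat_ker (cyc l) (adj_mat l D2)" and X: "X \<in> carrier (homology l D1 D2)"
  shows "class_coeff w m (c \<odot>\<^bsub>homology l D1 D2\<^esub> X) = c * class_coeff w m X"
proof -
  have cX: "c \<odot>\<^bsub>homology l D1 D2\<^esub> X \<in> carrier (homology l D1 D2)"
    using X by (intro H.smult_closed) auto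
  obtain x where x: "x \<in> X" "x \<in> carrier_vec (dim_col D1)" using carrier_homology_rep X by blast
  have "c \<odot>\<^bsub>homology l D1 D2\<^esub> X =
      (\<Union>v\<in>X. \<Union>z\<in>mat_im (cyc l) D2. {z + map_vec (Polynomial.smult c) v})"
    by (simp add: homology_def quot_space_def a_r_coset_def')
  then have "0\<^sub>v (dim_col D1) + map_vec (Polynomial.smult c) x \<in> c \<odot>\<^bsub>homology l D1 D2\<^esub> X"
    using x(1) zero_mat_im unfolding dims by blast
  then have "class_coeff w m (c \<odot>\<^bsub>homology l D1 D2\<^esub> X) =
      pair_coeff w m (0\<^sub>v (dim_col D1) + map_vec (Polynomial.smult c) x)"
    by (rule class_coeff_eq[OF w cX])
  then show ?thesis
    using x(2) class_coeff_eq[OF w X x(1), of m] by (simp add: bin_smult pair_coeff_zero)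
qed

text \<open>The pairing is linear over R in its first argument, so the shifted vector pairs to x^m'
  or to 0. As \<open>m' < l\<close>, this monomial is already reduced and its coefficients can be
  read off.\<close>

lemma pair_coeff_shift:
  assumes "u \<in> carrier_vec (dim_col D1)" "m' < l"
    and "(\<Sum>i<dim_col D1. u $ i * conj_R l (w $ i)) mod cyc l = of_bool P mod cyc l"
  shows "pair_coeff w m (reduce_vec (cyc l) (monom 1 m' \<cdot>\<^sub>v u)) = of_bool (P \<and> m' = m)"
proof -
  have "(\<Sum>i<dim_col D1. reduce_vec (cyc l) (monom 1 m' \<cdot>\<^sub>v u) $ i * conj_R l (w $ i)) mod cyc l =
      (\<Sum>i<dim_col D1. ((monom 1 m' * u $ i) mod cyc l) * conj_R l (w $ i)) mod cyc l"
    using assms(1) by (intro arg_cong[of _ _ "\<lambda>x. x mod cyc l"] sum.cong) (auto simp: reduce_vec_def)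
  also have "\<dots> = (monom 1 m' * (\<Sum>i<dim_col D1. u $ i * conj_R l (w $ i))) mod cyc l"
    unfolding sum_distrib_left
    by (subst (1 2) mod_sum_eq[symmetric]) (simp add: mod_mult_left_eq mult.assoc)
  also have "\<dots> = (monom 1 m' * (of_bool P mod cyc l)) mod cyc l"
    unfolding assms(3)[symmetric] by (simp only: mod_mult_right_eq)
  also have "\<dots> = (monom 1 m' * of_bool P) mod cyc l" by (rule mod_mult_right_eq)
  also have "\<dots> = (if P then monom 1 m' else 0)" using monom_mod_cyc[OF assms(2)] by simp
  finally show ?thesis by (simp add: pair_coeff_def)
qed

lemma reduce_mat_ker:
  assumes "v \<in> mat_ker (cyc l) D1"
  shows "reduce_vec (cyc l) (c \<cdot>\<^sub>v v) \<in> mat_ker (cyc l) D1"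
proof -
  have "v \<in> carrier_vec (dim_col D1)" "mat_app (cyc l) D1 v = 0\<^sub>v (dim_row D1)"
    using assms by (auto simp: mat_ker_def vecs_def)
  then have "mat_app (cyc l) D1 (reduce_vec (cyc l) (c \<cdot>\<^sub>v v)) = 0\<^sub>v (dim_row D1)"
    by (simp add: mat_app_reduce_vec mat_app_smult) (auto simp: reduce_vec_def)
  then show ?thesis using \<open>v \<in> carrier_vec (dim_col D1)\<close>
    by (auto simp: mat_ker_def) (auto simp: vecs_def reduce_vec_def)
qed

end

text \<open>Duality is required over R only; the shifts needed over F_2 follow from it. The locale
  is instantiated for homology and, with the families exchanged, for cohomology.\<close>

locale dual_families = chain_complex +
  fixes u w :: "'i \<Rightarrow> bit poly vec" and N :: "'i set"
  assumes fin: "finite N"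
    and u: "\<And>k. k \<in> N \<Longrightarrow> u k \<in> mat_ker (cyc l) D1"
    and w: "\<And>k. k \<in> N \<Longrightarrow> w k \<in> mat_ker (cyc l) (adj_mat l D2)"
    and dual: "\<And>k k'. k \<in> N \<Longrightarrow> k' \<in> N \<Longrightarrow>
      (\<Sum>i<dim_col D1. u k $ i * conj_R l (w k' $ i)) mod cyc l = of_bool (k = k') mod cyc l"
begin

definition shift :: "nat \<times> 'i \<Rightarrow> bit poly vec" where
  "shift p = reduce_vec (cyc l) (monom 1 (fst p) \<cdot>\<^sub>v u (snd p))"

lemma shift_mat_ker: "p \<in> {..<l} \<times> N \<Longrightarrow> shift p \<in> mat_ker (cyc l) D1"
  unfolding shift_def using u by (intro reduce_mat_ker) auto

text \<open>Duality over F_2: coefficient m of the pairing with \<open>w k\<close> singles out the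
  shift of \<open>u k\<close> by x^m. Distinctness of the classes and their independence both follow
  from this.\<close>

lemma class_coeff_shift:
  assumes "p \<in> {..<l} \<times> N" "p' \<in> {..<l} \<times> N"
  shows "class_coeff (w (snd p)) (fst p) (hom_class l D1 D2 (shift p')) = of_bool (p = p')"
proof -
  have "u (snd p') \<in> carrier_vec (dim_col D1)" using u assms(2) by (auto simp: mat_ker_def vecs_def)
  then have "pair_coeff (w (snd p)) (fst p) (shift p') = of_bool (snd p' = snd p \<and> fst p' = fst p)"
    unfolding shift_def
  proof (rule pair_coeff_shift)
    show "fst p' < l" using assms(2) by auto
    show "(\<Sum>i<dim_col D1. u (snd p') $ i * conj_R l (w (snd p) $ i)) mod cyc l =
        of_bool (snd p' = snd p) mod cyc l"
      using assms by (intro dual) auto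
  qed
  moreover have "class_coeff (w (snd p)) (fst p) (hom_class l D1 D2 (shift p')) =
      pair_coeff (w (snd p)) (fst p) (shift p')"
  proof (rule class_coeff_eq)
    show "w (snd p) \<in> mat_ker (cyc l) (adj_mat l D2)" using assms(1) w by auto
    show "hom_class l D1 D2 (shift p') \<in> carrier (homology l D1 D2)"
      unfolding carrier_homology using shift_mat_ker[OF assms(2)] by (rule imageI)
    show "shift p' \<in> hom_class l D1 D2 (shift p')"
      by (rule hom_class_self[OF shift_mat_ker[OF assms(2)]])
  qed
  moreover have "(snd p' = snd p \<and> fst p' = fst p) = (p = p')" by (cases p, cases p') auto
  ultimately show ?thesis by simp
qed

lemma inj_on_hom_class_shift: "inj_on (hom_class l D1 D2 \<circ> shift) ({..<l} \<times> N)"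
proof (rule inj_onI)
  fix p p' assume p: "p \<in> {..<l} \<times> N" "p' \<in> {..<l} \<times> N"
    and "(hom_class l D1 D2 \<circ> shift) p = (hom_class l D1 D2 \<circ> shift) p'"
  then have "of_bool (p = p) = (of_bool (p = p') :: bit)"
    using class_coeff_shift[OF p(1) p(1)] class_coeff_shift[OF p(1) p(2)] by simp
  then show "p = p'" by (simp split: if_splits)
qed

lemma shift_classes: "(hom_class l D1 D2 \<circ> shift) ` ({..<l} \<times> N) \<subseteq> carrier (homology l D1 D2)"
  using shift_mat_ker unfolding carrier_homology by auto

lemma lin_indpt_shift: "\<not> H.lin_dep ((hom_class l D1 D2 \<circ> shift) ` ({..<l} \<times> N))"
proof -
  let ?c = "hom_class l D1 D2 \<circ> shift" and ?P = "{..<l} \<times> N"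
  \<comment> \<open>Linear independence concerns a set of classes, so the functional attached to a
    class is found by recovering its index pair.\<close>
  let ?i = "the_inv_into ?P ?c"
  have i: "?i (?c p) = p" if "p \<in> ?P" for p
    by (rule the_inv_into_f_f[OF inj_on_hom_class_shift that])
  show ?thesis
  proof (rule H.lin_indpt_dual[where f = "\<lambda>s. class_coeff (w (snd (?i s))) (fst (?i s))"])
    show "finite (?c ` ?P)" using fin by simp
    show "?c ` ?P \<subseteq> carrier (homology l D1 D2)" by (rule shift_classes)
  next
    fix s t assume "s \<in> ?c ` ?P" "t \<in> ?c ` ?P"
    then obtain p p' where p: "p \<in> ?P" "p' \<in> ?P" "s = ?c p" "t = ?c p'" by blast
    then show "class_coeff (w (snd (?i s))) (fst (?i s)) t =
        (if s = t then \<one>\<^bsub>class_ring\<^esub> else \<zero>\<^bsub>class_ring\<^esub>)"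
      using i class_coeff_shift[OF p(1,2)] inj_on_eq_iff[OF inj_on_hom_class_shift p(1,2)]
      by simp
  next
    fix s x y assume s: "s \<in> ?c ` ?P" and xy: "x \<in> carrier (homology l D1 D2)" "y \<in> carrier (homology l D1 D2)"
    have "w (snd (?i s)) \<in> mat_ker (cyc l) (adj_mat l D2)" using s i w by auto
    then show "class_coeff (w (snd (?i s))) (fst (?i s)) (x \<oplus>\<^bsub>homology l D1 D2\<^esub> y) =
       class_coeff (w (snd (?i s))) (fst (?i s)) x \<oplus>\<^bsub>class_ring\<^esub> class_coeff (w (snd (?i s))) (fst (?i s)) y"
      using xy by (simp add: class_coeff_add)
  next
    fix s c x assume s: "s \<in> ?c ` ?P" and x: "x \<in> carrier (homology l D1 D2)"
    have "w (snd (?i s)) \<in> mat_ker (cyc l) (adj_mat l D2)" using s i w by auto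
    then show "class_coeff (w (snd (?i s))) (fst (?i s)) (c \<odot>\<^bsub>homology l D1 D2\<^esub> x) =
       c \<otimes>\<^bsub>class_ring\<^esub> class_coeff (w (snd (?i s))) (fst (?i s)) x"
      using x by (simp add: class_coeff_smult)
  qed simp
qed

lemma card_hom_class_shift: "card (hom_class l D1 D2 ` shift ` ({..<l} \<times> N)) = card N * l"
  using card_image[OF inj_on_hom_class_shift]
  by (simp add: image_comp card_cartesian_product mult.commute)

lemma card_le_dim_homology: "card N * l \<le> vectorspace.dim class_ring (homology l D1 D2)"
proof -
  have "card ((hom_class l D1 D2 \<circ> shift) ` ({..<l} \<times> N)) \<le> H.dim"
    by (rule H.li_le_dim(2)[OF H.fin_dim_finite[OF finite_homology] shift_classes lin_indpt_shift])
  then show ?thesis using card_hom_class_shift by (simp add: image_comp)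
qed

text \<open>The extension takes place among classes and is then lifted: the shifts remain their own
  representatives, and only the added classes receive chosen ones.\<close>

lemma extend_to_basis:
  "\<exists>S. represents_basis l D1 D2 S \<and> shift ` ({..<l} \<times> N) \<subseteq> S"
proof -
  let ?c = "hom_class l D1 D2" and ?L = "shift ` ({..<l} \<times> N)"
  have L: "?L \<subseteq> mat_ker (cyc l) D1" using shift_mat_ker by blast
  have indpt: "\<not> H.lin_dep (?c ` ?L)" using lin_indpt_shift by (simp add: image_comp)
  have inj: "inj_on ?c ?L" using inj_on_hom_class_shift by (rule inj_on_imageI)
  have "?c ` ?L \<subseteq> carrier (homology l D1 D2)" using shift_classes by (simp add: image_comp)
  from H.lin_indpt_extend[OF finite_homology this indpt]
  obtain T where T: "?c ` ?L \<subseteq> T" "H.basis T" by (elim exE conjE)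
  have Tc: "T \<subseteq> ?c ` mat_ker (cyc l) D1"
    using T(2) unfolding H.basis_def carrier_homology by blast
  define r where "r X = inv_into (mat_ker (cyc l) D1) ?c X" for X
  have r: "r X \<in> mat_ker (cyc l) D1" "?c (r X) = X" if "X \<in> T" for X
    using subsetD[OF Tc that] unfolding r_def by (rule inv_into_into, rule f_inv_into_f)
  \<comment> \<open>Removing the classes of \<open>?L\<close> from \<open>T\<close> first keeps the
    two parts disjoint on the level of classes, so that the class map stays injective on the
    union.\<close>
  define S where "S = ?L \<union> r ` (T - ?c ` ?L)"
  have cr: "?c ` r ` (T - ?c ` ?L) = T - ?c ` ?L" unfolding image_image using r(2) by simp
  have cS: "?c ` S = T"
    unfolding S_def image_Un cr Un_Diff_cancel by (rule Un_absorb1[OF T(1)])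
  have "inj_on ?c (r ` (T - ?c ` ?L))"
    by (rule inj_on_inverseI[of _ r]) (use r(2) in auto)
  moreover have "?c ` ?L \<inter> ?c ` r ` (T - ?c ` ?L) = {}" unfolding cr by (rule Diff_disjoint)
  then have "?c ` (?L - r ` (T - ?c ` ?L)) \<inter> ?c ` (r ` (T - ?c ` ?L) - ?L) = {}"
    by (rule disjoint_mono[OF image_mono[OF Diff_subset] image_mono[OF Diff_subset]])
  ultimately have "inj_on ?c S"
    unfolding S_def inj_on_Un using inj by simp
  moreover have "S \<subseteq> mat_ker (cyc l) D1" using L r(1) by (auto simp: S_def)
  ultimately have "represents_basis l D1 D2 S"
    using T(2) unfolding represents_basis_def cS by blast
  then show ?thesis by (auto simp: S_def)
qed

end

section \<open>The lifted-product complex\<close>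

text \<open>Kronecker products number the pair (i, j) as i n + j; this and the next two lemmas
  translate between such indices and pairs.\<close>

lemma sum_div_mod:
  fixes f :: "nat \<Rightarrow> nat \<Rightarrow> 'a :: comm_monoid_add"
  shows "(\<Sum>k<m * n. f (k div n) (k mod n)) = (\<Sum>i<m. \<Sum>j<n. f i j)"
proof -
  have "(\<Sum>k\<in>{i * n..<i * n + n}. f (k div n) (k mod n)) = (\<Sum>j<n. f i j)" for i
  proof -
    have "(\<Sum>k\<in>{i * n..<i * n + n}. f (k div n) (k mod n)) =
        (\<Sum>j\<in>{0..<n}. f ((j + i * n) div n) ((j + i * n) mod n))"
      using sum.shift_bounds_nat_ivl[of "\<lambda>k. f (k div n) (k mod n)" 0 "i * n" n]
      by (simp add: add.commute)
    also have "\<dots> = (\<Sum>j\<in>{0..<n}. f i j)" by (rule sum.cong) auto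
    finally show ?thesis by (simp add: lessThan_atLeast0)
  qed
  then show ?thesis by (simp flip: sum.nat_group)
qed

lemma sum_div_mod_prod:
  fixes f g :: "nat \<Rightarrow> 'a :: semiring_0"
  shows "(\<Sum>k<m * n. f (k div n) * g (k mod n)) = (\<Sum>i<m. f i) * (\<Sum>j<n. g j)"
  unfolding sum_div_mod[of "\<lambda>i j. f i * g j"] sum_product ..

lemma all_div_mod:
  "(\<forall>k<m * n. P (k div n) (k mod n)) \<longleftrightarrow> (\<forall>i<m. \<forall>j<n. P i j)" for m n :: nat
proof (intro iffI allI impI)
  fix i j assume all: "\<forall>k<m * n. P (k div n) (k mod n)" and i: "i < m" and j: "j < n"
  have "i * n + j < Suc i * n" using j by simp
  also have "\<dots> \<le> m * n" using i by (intro mult_le_mono1) simp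
  finally show "P i j" using all[rule_format, of "i * n + j"] j by simp
next
  fix k assume all: "\<forall>i<m. \<forall>j<n. P i j" and k: "k < m * n"
  then have "n > 0" by (cases n) auto
  then show "P (k div n) (k mod n)" using all k by (simp add: less_mult_imp_div_less)
qed

lemma sum_split_lessThan:
  fixes f :: "nat \<Rightarrow> 'a :: comm_monoid_add"
  shows "(\<Sum>k<m + n. f k) = (\<Sum>k<m. f k) + (\<Sum>k<n. f (m + k))"
  by (induction n) (simp_all add: add.assoc)

lemma sum_of_bool:
  fixes f :: "nat \<Rightarrow> 'a :: comm_semiring_1"
  assumes "i < n"
  shows "(\<Sum>k<n. of_bool (i = k) * f k) = f i" "(\<Sum>k<n. of_bool (k = i) * f k) = f i"
    "(\<Sum>k<n. f k * of_bool (k = i)) = f i"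
proof -
  have "(\<Sum>k<n. of_bool (i = k) * f k) = (\<Sum>k<n. if i = k then f k else 0)"
    by (intro sum.cong) auto
  then show *: "(\<Sum>k<n. of_bool (i = k) * f k) = f i" using assms by simp
  have "(\<Sum>k<n. of_bool (k = i) * f k) = (\<Sum>k<n. of_bool (i = k) * f k)"
    by (intro sum.cong) auto
  then show "(\<Sum>k<n. of_bool (k = i) * f k) = f i" using * by simp
  have "(\<Sum>k<n. f k * of_bool (k = i)) = (\<Sum>k<n. of_bool (i = k) * f k)"
    by (intro sum.cong) auto
  then show "(\<Sum>k<n. f k * of_bool (k = i)) = f i" using * by simp
qed

lemma dim_bd [simp]:
  "dim_row (bd1 A B) = dim_row A * dim_row B"
  "dim_col (bd1 A B) = dim_col A * dim_row B + dim_row A * dim_col B"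
  "dim_row (bd2 A B) = dim_col A * dim_row B + dim_row A * dim_col B"
  "dim_col (bd2 A B) = dim_col A * dim_col B"
  by (simp_all add: bd1_def bd2_def append_cols_def append_rows_def kron_def)

lemma div_mod_less:
  fixes k m n :: nat
  assumes "k < m * n"
  shows "k div n < m" "k mod n < n"
proof -
  have "n > 0" using assms by (cases n) auto
  then show "k div n < m" "k mod n < n" using assms by (simp_all add: less_mult_imp_div_less)
qed

lemma bd1_index:
  assumes "i < dim_row A * dim_row B"
  shows "k < dim_col A * dim_row B \<Longrightarrow> bd1 A B $$ (i, k) =
      A $$ (i div dim_row B, k div dim_row B) * of_bool (i mod dim_row B = k mod dim_row B)"
    and "k < dim_row A * dim_col B \<Longrightarrow> bd1 A B $$ (i, dim_col A * dim_row B + k) =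
      of_bool (i div dim_row B = k div dim_col B) * B $$ (i mod dim_row B, k mod dim_col B)"
  using assms div_mod_less[of i "dim_row A" "dim_row B"] div_mod_less[of k "dim_col A" "dim_row B"]
    div_mod_less[of k "dim_row A" "dim_col B"]
  by (auto simp: bd1_def append_cols_def kron_def)

lemma bd2_index:
  assumes "c < dim_col A * dim_col B"
  shows "k < dim_col A * dim_row B \<Longrightarrow> bd2 A B $$ (k, c) =
      of_bool (k div dim_row B = c div dim_col B) * B $$ (k mod dim_row B, c mod dim_col B)"
    and "k < dim_row A * dim_col B \<Longrightarrow> bd2 A B $$ (dim_col A * dim_row B + k, c) =
      A $$ (k div dim_col B, c div dim_col B) * of_bool (k mod dim_col B = c mod dim_col B)"
  using assms div_mod_less[of c "dim_col A" "dim_col B"] div_mod_less[of k "dim_col A" "dim_row B"]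
    div_mod_less[of k "dim_row A" "dim_col B"]
  by (auto simp: bd2_def append_rows_def kron_def)

lemma bd1_bd2:
  assumes i: "i < dim_row A * dim_row B" and c: "c < dim_col A * dim_col B"
  shows "(\<Sum>k<dim_col (bd1 A B). bd1 A B $$ (i, k) * bd2 A B $$ (k, c)) = 0"
proof -
  let ?mB = "dim_row B" and ?nB = "dim_col B"
  let ?r = "i div ?mB" and ?t = "i mod ?mB" and ?p = "c div ?nB" and ?d = "c mod ?nB"
  note less = div_mod_less[OF i] div_mod_less[OF c]
  have "(\<Sum>k<dim_col A * ?mB. bd1 A B $$ (i, k) * bd2 A B $$ (k, c)) =
      (\<Sum>k<dim_col A * ?mB. (of_bool (k div ?mB = ?p) * A $$ (?r, k div ?mB)) *
        (of_bool (?t = k mod ?mB) * B $$ (k mod ?mB, ?d)))"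
    using i c by (intro sum.cong) (auto simp: bd1_index bd2_index)
  also have "\<dots> = A $$ (?r, ?p) * B $$ (?t, ?d)"
    using less sum_div_mod_prod[where f = "\<lambda>p. of_bool (p = ?p) * A $$ (?r, p)"
        and g = "\<lambda>s. of_bool (?t = s) * B $$ (s, ?d)"]
    by (simp only: sum_of_bool)
  finally have 1: "(\<Sum>k<dim_col A * ?mB. bd1 A B $$ (i, k) * bd2 A B $$ (k, c)) =
      A $$ (?r, ?p) * B $$ (?t, ?d)" .
  have "(\<Sum>k<dim_row A * ?nB. bd1 A B $$ (i, dim_col A * ?mB + k) * bd2 A B $$ (dim_col A * ?mB + k, c)) =
      (\<Sum>k<dim_row A * ?nB. (of_bool (?r = k div ?nB) * A $$ (k div ?nB, ?p)) *
        (of_bool (k mod ?nB = ?d) * B $$ (?t, k mod ?nB)))"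
    using i c by (intro sum.cong) (auto simp: bd1_index bd2_index)
  also have "\<dots> = A $$ (?r, ?p) * B $$ (?t, ?d)"
    using less sum_div_mod_prod[where f = "\<lambda>r. of_bool (?r = r) * A $$ (r, ?p)"
        and g = "\<lambda>d. of_bool (d = ?d) * B $$ (?t, d)"]
    by (simp only: sum_of_bool)
  finally have 2: "(\<Sum>k<dim_row A * ?nB. bd1 A B $$ (i, dim_col A * ?mB + k) * bd2 A B $$ (dim_col A * ?mB + k, c)) =
      A $$ (?r, ?p) * B $$ (?t, ?d)" .
  have "x + x = 0" for x :: "bit poly" using two_bit_poly mult_2[of x] by simp
  then show ?thesis unfolding dim_bd sum_split_lessThan 1 2 .
qed

lemma mat_im_subset_mat_ker:
  assumes dim: "dim_row D2 = dim_col D1"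
    and zero: "\<And>i c. i < dim_row D1 \<Longrightarrow> c < dim_col D2 \<Longrightarrow>
      q dvd (\<Sum>k<dim_col D1. D1 $$ (i, k) * D2 $$ (k, c))"
  shows "mat_im q D2 \<subseteq> mat_ker q D1"
proof
  fix z assume "z \<in> mat_im q D2"
  then obtain y where y: "y \<in> vecs q (dim_col D2)" "z = mat_app q D2 y" by (auto simp: mat_im_def)
  then have z: "z = vec (dim_col D1) (\<lambda>k. (\<Sum>c<dim_col D2. D2 $$ (k, c) * y $ c) mod q)"
    by (intro eq_vecI) (auto simp: index_mat_app dim vecs_def mat_app_def reduce_vec_def
        scalar_prod_def lessThan_atLeast0)
  show "z \<in> mat_ker q D1"
    unfolding z vec_mod_mat_ker_iff
  proof (intro allI impI)
    fix i assume i: "i < dim_row D1"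
    have "(\<Sum>k<dim_col D1. D1 $$ (i, k) * (\<Sum>c<dim_col D2. D2 $$ (k, c) * y $ c)) =
        (\<Sum>k<dim_col D1. \<Sum>c<dim_col D2. y $ c * (D1 $$ (i, k) * D2 $$ (k, c)))"
      by (simp add: sum_distrib_left mult_ac)
    also have "\<dots> = (\<Sum>c<dim_col D2. y $ c * (\<Sum>k<dim_col D1. D1 $$ (i, k) * D2 $$ (k, c)))"
      unfolding sum_distrib_left by (rule sum.swap)
    also have "q dvd \<dots>" by (rule dvd_sum[OF dvd_mult]) (simp add: zero i)
    finally show "q dvd (\<Sum>k<dim_col D1. D1 $$ (i, k) * (\<Sum>c<dim_col D2. D2 $$ (k, c) * y $ c))" .
  qed
qed

lemma chain_complex_bd:
  assumes "0 < l"
  shows "chain_complex l (bd1 A B) (bd2 A B)"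
proof (unfold_locales, rule assms, rule mat_im_subset_mat_ker)
  fix i c assume "i < dim_row (bd1 A B)" "c < dim_col (bd2 A B)"
  then show "cyc l dvd (\<Sum>k<dim_col (bd1 A B). bd1 A B $$ (i, k) * bd2 A B $$ (k, c))"
    by (subst bd1_bd2) simp_all
qed simp

lemma chain_complex_adj_bd:
  assumes "0 < l"
  shows "chain_complex l (adj_mat l (bd2 A B)) (adj_mat l (bd1 A B))"
proof (unfold_locales, rule assms, rule mat_im_subset_mat_ker)
  let ?D1 = "bd1 A B" and ?D2 = "bd2 A B"
  fix c i assume c: "c < dim_row (adj_mat l ?D2)" and i: "i < dim_col (adj_mat l ?D1)"
  have "(\<Sum>k<dim_col ?D1. adj_mat l ?D2 $$ (c, k) * adj_mat l ?D1 $$ (k, i)) =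
      (\<Sum>k<dim_col ?D1. conj_R l (?D1 $$ (i, k)) * conj_R l (?D2 $$ (k, c)))"
    using c i by (intro sum.cong) auto
  moreover have "\<dots> mod cyc l = 0"
    using c i unfolding conj_R_sum_mult[symmetric] by (subst bd1_bd2) simp_all
  ultimately show "cyc l dvd (\<Sum>k<dim_col (adj_mat l ?D2). adj_mat l ?D2 $$ (c, k) * adj_mat l ?D1 $$ (k, i))"
    by (simp add: mod_0_imp_dvd)
qed simp

text \<open>The element of the middle module formed by a tensor b in the first summand and zeros in
  the second, of length \<open>r\<close>. The factors are functions, so they may be unreduced or
  reindexed by a permutation.\<close>

definition tensor_vec ::
    "bit poly \<Rightarrow> nat \<Rightarrow> nat \<Rightarrow> nat \<Rightarrow> (nat \<Rightarrow> bit poly) \<Rightarrow> (nat \<Rightarrow> bit poly) \<Rightarrow> bit poly vec" where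
  "tensor_vec q m n r a b = vec (m * n + r)
     (\<lambda>k. (if k < m * n then a (k div n) * b (k mod n) else 0) mod q)"

text \<open>The first boundary map sends a tensor b to (A a) tensor b, and the zero summand
  contributes nothing.\<close>

lemma tensor_vec_mat_ker_bd1:
  "tensor_vec q (dim_col A) (dim_row B) (dim_row A * dim_col B) a b \<in> mat_ker q (bd1 A B) \<longleftrightarrow>
    (\<forall>i<dim_row A. \<forall>s<dim_row B. q dvd (\<Sum>p<dim_col A. A $$ (i, p) * a p) * b s)"
proof -
  let ?mB = "dim_row B"
  let ?c = "\<lambda>k. if k < dim_col A * ?mB then a (k div ?mB) * b (k mod ?mB) else 0"
  have "(\<Sum>k<dim_col (bd1 A B). bd1 A B $$ (i, k) * ?c k) =
      (\<Sum>p<dim_col A. A $$ (i div ?mB, p) * a p) * b (i mod ?mB)" if i: "i < dim_row A * ?mB" for i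
  proof -
    have "(\<Sum>k<dim_col (bd1 A B). bd1 A B $$ (i, k) * ?c k) =
        (\<Sum>k<dim_col A * ?mB. bd1 A B $$ (i, k) * ?c k)"
      by (simp add: sum_split_lessThan)
    also have "\<dots> = (\<Sum>k<dim_col A * ?mB.
        (A $$ (i div ?mB, k div ?mB) * a (k div ?mB)) * (of_bool (i mod ?mB = k mod ?mB) * b (k mod ?mB)))"
      using i by (intro sum.cong) (auto simp: bd1_index)
    also have "\<dots> = (\<Sum>p<dim_col A. A $$ (i div ?mB, p) * a p) * b (i mod ?mB)"
      using div_mod_less(2)[OF i] sum_div_mod_prod[where f = "\<lambda>p. A $$ (i div ?mB, p) * a p"
        and g = "\<lambda>s. of_bool (i mod ?mB = s) * b s"]
      by (simp only: sum_of_bool)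
    finally show ?thesis .
  qed
  then show ?thesis
    using vec_mod_mat_ker_iff[of "bd1 A B" ?c q]
      all_div_mod[of "dim_row A" ?mB "\<lambda>i s. q dvd (\<Sum>p<dim_col A. A $$ (i, p) * a p) * b s"]
    by (simp add: tensor_vec_def)
qed

text \<open>The adjoint of the second boundary map leaves the first factor alone and applies the
  adjoint of \<open>B\<close> to the second.\<close>

lemma tensor_vec_mat_ker_adj_bd2:
  "tensor_vec q (dim_col A) (dim_row B) (dim_row A * dim_col B) a b \<in> mat_ker q (adj_mat l (bd2 A B)) \<longleftrightarrow>
    (\<forall>p<dim_col A. \<forall>c<dim_col B. q dvd a p * (\<Sum>s<dim_row B. adj_mat l B $$ (c, s) * b s))"
proof -
  let ?mB = "dim_row B" and ?nB = "dim_col B"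
  let ?c = "\<lambda>k. if k < dim_col A * ?mB then a (k div ?mB) * b (k mod ?mB) else 0"
  have "(\<Sum>k<dim_row (bd2 A B). adj_mat l (bd2 A B) $$ (c, k) * ?c k) =
      a (c div ?nB) * (\<Sum>s<dim_row B. adj_mat l B $$ (c mod ?nB, s) * b s)"
    if c: "c < dim_col A * ?nB" for c
  proof -
    have "(\<Sum>k<dim_row (bd2 A B). adj_mat l (bd2 A B) $$ (c, k) * ?c k) =
        (\<Sum>k<dim_col A * ?mB. adj_mat l (bd2 A B) $$ (c, k) * ?c k)"
      by (simp add: sum_split_lessThan)
    also have "\<dots> = (\<Sum>k<dim_col A * ?mB. (of_bool (k div ?mB = c div ?nB) * a (k div ?mB)) *
        (adj_mat l B $$ (c mod ?nB, k mod ?mB) * b (k mod ?mB)))"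
    proof (rule sum.cong)
      fix k assume "k \<in> {..<dim_col A * ?mB}"
      then show "adj_mat l (bd2 A B) $$ (c, k) * ?c k =
          (of_bool (k div ?mB = c div ?nB) * a (k div ?mB)) *
          (adj_mat l B $$ (c mod ?nB, k mod ?mB) * b (k mod ?mB))"
        using c div_mod_less[OF c] div_mod_less[of k "dim_col A" ?mB]
        by (cases "k div ?mB = c div ?nB") (auto simp: bd2_index)
    qed simp
    also have "\<dots> = a (c div ?nB) * (\<Sum>s<dim_row B. adj_mat l B $$ (c mod ?nB, s) * b s)"
      using div_mod_less(1)[OF c] sum_div_mod_prod[where f = "\<lambda>p. of_bool (p = c div ?nB) * a p"
        and g = "\<lambda>s. adj_mat l B $$ (c mod ?nB, s) * b s"]
      by (simp only: sum_of_bool)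
    finally show ?thesis .
  qed
  then show ?thesis
    using vec_mod_mat_ker_iff[of "adj_mat l (bd2 A B)" ?c q]
      all_div_mod[of "dim_col A" ?nB "\<lambda>p c. q dvd a p * (\<Sum>s<dim_row B. adj_mat l B $$ (c, s) * b s)"]
    by (simp add: tensor_vec_def)
qed

text \<open>The pairing of pure tensors factors into the pairings of their factors.\<close>

lemma tensor_vec_pairing:
  assumes "0 < l"
  shows "(\<Sum>k<m * n + r. tensor_vec (cyc l) m n r a b $ k * conj_R l (tensor_vec (cyc l) m n r a' b' $ k)) mod cyc l =
    ((\<Sum>p<m. a p * conj_R l (a' p)) * (\<Sum>s<n. b s * conj_R l (b' s))) mod cyc l"
proof -
  let ?q = "cyc l"
  let ?t = "\<lambda>k. tensor_vec ?q m n r a b $ k * conj_R l (tensor_vec ?q m n r a' b' $ k)"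
  let ?f = "\<lambda>p s. (a p * conj_R l (a' p)) * (b s * conj_R l (b' s))"
  have "(\<Sum>k<m * n + r. ?t k) = (\<Sum>k<m * n. ?t k)"
    unfolding sum_split_lessThan by (simp add: tensor_vec_def)
  moreover have "?t k mod ?q = ?f (k div n) (k mod n) mod ?q" if "k < m * n" for k
  proof -
    have "?t k = (a (k div n) * b (k mod n)) mod ?q * ((conj_R l (a' (k div n)) * conj_R l (b' (k mod n))) mod ?q)"
      using that by (simp add: tensor_vec_def conj_R_mod[OF assms] conj_R_mult)
    then show ?thesis by (simp only: mod_mult_eq mult_ac)
  qed
  then have "(\<Sum>k<m * n. ?t k) mod ?q = (\<Sum>k<m * n. ?f (k div n) (k mod n)) mod ?q"
    by (subst (1 2) mod_sum_eq[symmetric]) simp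
  moreover have "(\<Sum>k<m * n. ?f (k div n) (k mod n)) =
      (\<Sum>p<m. a p * conj_R l (a' p)) * (\<Sum>s<n. b s * conj_R l (b' s))"
    by (rule sum_div_mod_prod)
  ultimately show ?thesis by simp
qed

section \<open>Canonical bases\<close>

lemma one_mod_cyc: "0 < l \<Longrightarrow> 1 mod cyc l = 1"
  using monom_mod_cyc[of 0 l] by simp

lemma conj_R_of_bool: "0 < l \<Longrightarrow> conj_R l (of_bool P) = of_bool P"
  by (simp add: conj_R_1 one_mod_cyc)

text \<open>\<open>a i\<close> are kernel vectors of \<open>A\<close> with unit entries at the
  positions \<alpha>, and \<open>h j\<close> those of the adjoint of \<open>B\<close> at the
  positions \<sigma>. Keeping the positions variable serves both the permuted matrices, with
  positions in front, and the original ones.\<close>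

locale dual_tensor_rows =
  fixes l :: nat and A B :: "bit poly mat" and rA rB :: nat
    and a h :: "nat \<Rightarrow> nat \<Rightarrow> bit poly" and \<alpha> \<sigma> :: "nat \<Rightarrow> nat"
  assumes l_pos: "0 < l"
    and a_ker: "\<And>i t. i < rA \<Longrightarrow> t < dim_row A \<Longrightarrow> cyc l dvd (\<Sum>p<dim_col A. A $$ (t, p) * a i p)"
    and h_ker: "\<And>j c. j < rB \<Longrightarrow> c < dim_col B \<Longrightarrow>
      cyc l dvd (\<Sum>s<dim_row B. adj_mat l B $$ (c, s) * h j s)"
    and \<alpha>: "\<And>i. i < rA \<Longrightarrow> \<alpha> i < dim_col A" and \<sigma>: "\<And>j. j < rB \<Longrightarrow> \<sigma> j < dim_row B"
    and a_\<alpha>: "\<And>i i'. i < rA \<Longrightarrow> i' < rA \<Longrightarrow> a i (\<alpha> i') mod cyc l = of_bool (i = i') mod cyc l"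
    and h_\<sigma>: "\<And>j j'. j < rB \<Longrightarrow> j' < rB \<Longrightarrow> h j (\<sigma> j') mod cyc l = of_bool (j = j') mod cyc l"
begin

abbreviation tensor :: "(nat \<Rightarrow> bit poly) \<Rightarrow> (nat \<Rightarrow> bit poly) \<Rightarrow> bit poly vec" where
  "tensor \<equiv> tensor_vec (cyc l) (dim_col A) (dim_row B) (dim_row A * dim_col B)"

definition u :: "nat \<times> nat \<Rightarrow> bit poly vec" where
  "u x = tensor (a (fst x)) (\<lambda>s. of_bool (s = \<sigma> (snd x)))"

definition w :: "nat \<times> nat \<Rightarrow> bit poly vec" where
  "w x = tensor (\<lambda>p. of_bool (p = \<alpha> (fst x))) (h (snd x))"

abbreviation N :: "(nat \<times> nat) set" where
  "N \<equiv> {..<rA} \<times> {..<rB}"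

lemma u_ker: "x \<in> N \<Longrightarrow> u x \<in> mat_ker (cyc l) (bd1 A B)"
  unfolding u_def tensor_vec_mat_ker_bd1 using a_ker by auto

lemma w_ker: "x \<in> N \<Longrightarrow> w x \<in> mat_ker (cyc l) (adj_mat l (bd2 A B))"
  unfolding w_def tensor_vec_mat_ker_adj_bd2 using h_ker by auto

lemma conj_a_\<alpha>: "i < rA \<Longrightarrow> i' < rA \<Longrightarrow> conj_R l (a i (\<alpha> i')) = of_bool (i = i')"
  using arg_cong[OF a_\<alpha>, of i i' "conj_R l"] by (simp only: conj_R_mod[OF l_pos] conj_R_of_bool[OF l_pos])

lemma conj_h_\<sigma>: "j < rB \<Longrightarrow> j' < rB \<Longrightarrow> conj_R l (h j (\<sigma> j')) = of_bool (j = j')"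
  using arg_cong[OF h_\<sigma>, of j j' "conj_R l"] by (simp only: conj_R_mod[OF l_pos] conj_R_of_bool[OF l_pos])

text \<open>The pairing is the product of <a_i, e> and <e', h_j'> with unit vectors e at \<alpha> i'
  and e' at \<sigma> j; each factor reads off one systematic entry, conjugated in the second
  case.\<close>

lemma u_w_dual:
  assumes "x \<in> N" "y \<in> N"
  shows "(\<Sum>k<dim_col A * dim_row B + dim_row A * dim_col B. u x $ k * conj_R l (w y $ k)) mod cyc l =
    of_bool (x = y) mod cyc l"
proof -
  obtain i j i' j' where x: "x = (i, j)" and y: "y = (i', j')" by fastforce
  have less: "i < rA" "j < rB" "i' < rA" "j' < rB" using assms by (auto simp: x y)
  have "(\<Sum>p<dim_col A. a i p * conj_R l (of_bool (p = \<alpha> i'))) = a i (\<alpha> i')"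
    unfolding conj_R_of_bool[OF l_pos] by (rule sum_of_bool(3)[OF \<alpha>[OF less(3)]])
  moreover have "(\<Sum>s<dim_row B. of_bool (s = \<sigma> j) * conj_R l (h j' s)) = of_bool (j' = j)"
    using sum_of_bool(2)[OF \<sigma>[OF less(2)], of "\<lambda>s. conj_R l (h j' s)"]
    unfolding conj_h_\<sigma>[OF less(4,2)] .
  ultimately have "(\<Sum>k<dim_col A * dim_row B + dim_row A * dim_col B. u x $ k * conj_R l (w y $ k)) mod cyc l =
      (a i (\<alpha> i') * of_bool (j' = j)) mod cyc l"
    unfolding u_def w_def tensor_vec_pairing[OF l_pos] by (simp add: x y)
  also have "\<dots> = (of_bool (i = i') * of_bool (j' = j)) mod cyc l"
    by (rule mod_mult_cong[OF a_\<alpha>[OF less(1,3)] refl])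
  also have "of_bool (i = i') * of_bool (j' = j) = (of_bool (x = y) :: bit poly)"
    by (auto simp: x y)
  finally show ?thesis .
qed

lemma w_u_dual:
  assumes "x \<in> N" "y \<in> N"
  shows "(\<Sum>k<dim_col A * dim_row B + dim_row A * dim_col B. w x $ k * conj_R l (u y $ k)) mod cyc l =
    of_bool (x = y) mod cyc l"
proof -
  obtain i j i' j' where x: "x = (i, j)" and y: "y = (i', j')" by fastforce
  have less: "i < rA" "j < rB" "i' < rA" "j' < rB" using assms by (auto simp: x y)
  have "(\<Sum>p<dim_col A. of_bool (p = \<alpha> i) * conj_R l (a i' p)) = of_bool (i' = i)"
    using sum_of_bool(2)[OF \<alpha>[OF less(1)], of "\<lambda>p. conj_R l (a i' p)"]
    unfolding conj_a_\<alpha>[OF less(3,1)] .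
  moreover have "(\<Sum>s<dim_row B. h j s * conj_R l (of_bool (s = \<sigma> j'))) = h j (\<sigma> j')"
    unfolding conj_R_of_bool[OF l_pos] by (rule sum_of_bool(3)[OF \<sigma>[OF less(4)]])
  ultimately have "(\<Sum>k<dim_col A * dim_row B + dim_row A * dim_col B. w x $ k * conj_R l (u y $ k)) mod cyc l =
      (of_bool (i' = i) * h j (\<sigma> j')) mod cyc l"
    unfolding u_def w_def tensor_vec_pairing[OF l_pos] by (simp add: x y)
  also have "\<dots> = (of_bool (i' = i) * of_bool (j = j')) mod cyc l"
    by (rule mod_mult_cong[OF refl h_\<sigma>[OF less(2,4)]])
  also have "of_bool (i' = i) * of_bool (j = j') = (of_bool (x = y) :: bit poly)"
    by (auto simp: x y)
  finally show ?thesis .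
qed

sublocale Z: dual_families l "bd1 A B" "bd2 A B" u w N
proof (intro dual_families.intro chain_complex_bd l_pos dual_families_axioms.intro)
  fix x y assume "x \<in> N" "y \<in> N"
  then show "(\<Sum>k<dim_col (bd1 A B). u x $ k * conj_R l (w y $ k)) mod cyc l = of_bool (x = y) mod cyc l"
    unfolding dim_bd by (rule u_w_dual)
qed (simp_all add: u_ker w_ker)

text \<open>Cohomology is the same situation for the adjoint complex with \<open>u\<close> and
  \<open>w\<close> exchanged. Now \<open>u\<close> has to lie in the kernel of the double adjoint of
  \<open>bd1 A B\<close>, which is the kernel of \<open>bd1 A B\<close> itself.\<close>

sublocale X: dual_families l "adj_mat l (bd2 A B)" "adj_mat l (bd1 A B)" w u N
proof (intro dual_families.intro chain_complex_adj_bd l_pos dual_families_axioms.intro)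
  fix x y assume "x \<in> N" "y \<in> N"
  then show "(\<Sum>k<dim_col (adj_mat l (bd2 A B)). w x $ k * conj_R l (u y $ k)) mod cyc l =
      of_bool (x = y) mod cyc l"
    unfolding dim_bd dim_adj_mat by (rule w_u_dual)
qed (simp_all add: u_ker w_ker mat_ker_adj_adj[OF l_pos])

text \<open>Spelled out in terms of \<open>tensor\<close> so as to have literally the shape that
  \<open>LZ_rows_eq\<close> gives to the rows of the canonical basis.\<close>

definition Z_rows :: "bit poly vec set" where
  "Z_rows = (\<lambda>x. reduce_vec (cyc l) (monom 1 (fst x) \<cdot>\<^sub>v
     tensor (a (fst (snd x))) (\<lambda>s. of_bool (s = \<sigma> (snd (snd x)))))) ` ({..<l} \<times> N)"

definition X_rows :: "bit poly vec set" where
  "X_rows = (\<lambda>x. reduce_vec (cyc l) (monom 1 (fst x) \<cdot>\<^sub>v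
     tensor (\<lambda>p. of_bool (p = \<alpha> (fst (snd x)))) (h (snd (snd x))))) ` ({..<l} \<times> N)"

lemma Z_rows_eq: "Z_rows = Z.shift ` ({..<l} \<times> N)"
  unfolding Z_rows_def Z.shift_def[abs_def] by (simp only: u_def)

lemma X_rows_eq: "X_rows = X.shift ` ({..<l} \<times> N)"
  unfolding X_rows_def X.shift_def[abs_def] by (simp only: w_def)

lemma card_N: "card N = rA * rB"
  by (simp add: card_cartesian_product)

lemma ex_Z_basis: "\<exists>S. Z_basis l A B S \<and> Z_rows \<subseteq> S"
  unfolding Z_basis_def Z_rows_eq by (rule Z.extend_to_basis)

lemma ex_X_basis: "\<exists>S. X_basis l A B S \<and> X_rows \<subseteq> S"
  unfolding X_basis_def X_rows_eq by (rule X.extend_to_basis)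

lemma card_Z_class: "card (Z_class l A B ` Z_rows) = rA * rB * l"
  unfolding Z_class_def Z_rows_eq Z.card_hom_class_shift card_N ..

lemma card_X_class: "card (X_class l A B ` X_rows) = rA * rB * l"
  unfolding X_class_def X_rows_eq X.card_hom_class_shift card_N ..

lemma le_num_logical: "rA * rB * l \<le> num_logical l A B"
  unfolding num_logical_def card_N[symmetric] by (rule Z.card_le_dim_homology)

end

text \<open>Row \<open>i\<close> of \<open>(I\<^sub>r, G)\<close>.\<close>

definition sys_row :: "nat \<Rightarrow> bit poly mat \<Rightarrow> nat \<Rightarrow> nat \<Rightarrow> bit poly" where
  "sys_row r G i k = (if k < r then of_bool (i = k) else G $$ (i, k - r))"

text \<open>The divisibility says that the rows of (I, G) lie in the kernel of \<open>M\<close>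
  after its columns are permuted by \<open>p\<close>.\<close>

definition systematic_kernel ::
    "bit poly \<Rightarrow> bit poly mat \<Rightarrow> nat \<Rightarrow> (nat \<Rightarrow> nat) \<Rightarrow> bit poly mat \<Rightarrow> bool" where
  "systematic_kernel q M r p G \<longleftrightarrow> p permutes {..<dim_col M} \<and> G \<in> mats q r (dim_col M - r) \<and>
     (\<forall>i<r. \<forall>t<dim_row M. q dvd (\<Sum>k<dim_col M. M $$ (t, p k) * sys_row r G i k))"

lemma permutes_extending:
  assumes J: "J \<subseteq> {..<n}" "card J = r"
  shows "\<exists>p. p permutes {..<n} \<and> p ` {..<r} = J"
proof -
  have fin: "finite J" using J(1) finite_subset by blast
  have rn: "r \<le> n" using card_mono[OF _ J(1)] J(2) by simp
  obtain f where f: "bij_betw f {..<r} J"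
    using finite_same_card_bij[of "{..<r}" J] fin J(2) by auto
  have "card ({..<n} - J) = card ({..<n} - {..<r})"
    using J rn by (simp add: card_Diff_subset fin)
  then obtain g where g: "bij_betw g ({..<n} - {..<r}) ({..<n} - J)"
    using finite_same_card_bij[of "{..<n} - {..<r}" "{..<n} - J"] by auto
  define p where "p k = (if k < r then f k else if k < n then g k else k)" for k
  have 1: "bij_betw p {..<r} J"
    using f by (rule bij_betw_cong[THEN iffD1, rotated]) (simp add: p_def)
  have 2: "bij_betw p ({..<n} - {..<r}) ({..<n} - J)"
    using g by (rule bij_betw_cong[THEN iffD1, rotated]) (auto simp: p_def)
  have "bij_betw p ({..<r} \<union> ({..<n} - {..<r})) (J \<union> ({..<n} - J))"
    by (rule bij_betw_combine[OF 1 2]) auto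
  moreover have "{..<r} \<union> ({..<n} - {..<r}) = {..<n}" "J \<union> ({..<n} - J) = {..<n}"
    using rn J(1) by auto
  ultimately have "bij_betw p {..<n} {..<n}" by simp
  then have "p permutes {..<n}"
    by (rule bij_imp_permutes) (use rn in \<open>simp add: p_def\<close>)
  then show ?thesis using 1 by (auto simp: bij_betw_def)
qed

text \<open>The free set is where \<open>p\<close> puts the identity block. Conversely, freeness
  provides kernel vectors restricting to the unit vectors on \<open>J\<close>, and their remaining
  coordinates form \<open>G\<close>.\<close>

lemma systematic_kernel_iff_free_on:
  assumes q: "1 mod q = 1" and r: "r \<le> dim_col M"
  shows "(\<exists>p G. systematic_kernel q M r p G) \<longleftrightarrow>
    (\<exists>J\<subseteq>{..<dim_col M}. card J = r \<and> free_on q (mat_ker q M) J)"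
proof (rule iffI; elim exE conjE)
  fix p G assume sys: "systematic_kernel q M r p G"
  then have p: "p permutes {..<dim_col M}" by (simp add: systematic_kernel_def)
  let ?J = "p ` {..<r}"
  have "?J \<subseteq> p ` {..<dim_col M}" using r by (intro image_mono) auto
  then have J: "?J \<subseteq> {..<dim_col M}" unfolding permutes_image[OF p] .
  have "card ?J = r" using card_image[OF inj_on_subset[OF permutes_inj[OF p]], of "{..<r}"] by simp
  moreover have "free_on q (mat_ker q M) ?J"
  proof (rule free_on_unit_vectors[OF J])
    fix j assume "j \<in> ?J"
    then obtain i where i: "i < r" "j = p i" by blast
    \<comment> \<open>The permutation is undone, so that \<open>v\<close> is a kernel vector of
      \<open>M\<close> itself with its 1 at position \<open>p i\<close>.\<close>
    define v where "v = vec (dim_col M) (\<lambda>k. sys_row r G i (inv_into UNIV p k) mod q)"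
    have "q dvd (\<Sum>k<dim_col M. M $$ (t, k) * sys_row r G i (inv_into UNIV p k))" if t: "t < dim_row M" for t
    proof -
      have "(\<Sum>k<dim_col M. M $$ (t, k) * sys_row r G i (inv_into UNIV p k)) =
          (\<Sum>k<dim_col M. M $$ (t, p k) * sys_row r G i k)"
        by (subst sum.permute[OF p]) (simp add: o_def permutes_inverses(2)[OF p])
      then show ?thesis using sys i(1) t by (simp add: systematic_kernel_def)
    qed
    then have "v \<in> mat_ker q M" unfolding v_def vec_mod_mat_ker_iff by blast
    moreover have "v $ k = of_bool (k = j) mod q" if k: "k \<in> ?J" for k
    proof -
      obtain i' where i': "i' < r" "k = p i'" using k by blast
      then have "p i' < dim_col M" using J by blast
      then show ?thesis
        using i' i permutes_inj[OF p] by (auto simp: v_def permutes_inverses(2)[OF p] sys_row_def inj_eq)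
    qed
    ultimately show "\<exists>v\<in>mat_ker q M. \<forall>k\<in>?J. v $ k = of_bool (k = j) mod q" by blast
  qed
  ultimately show "\<exists>J\<subseteq>{..<dim_col M}. card J = r \<and> free_on q (mat_ker q M) J" using J by blast
next
  fix J assume J: "J \<subseteq> {..<dim_col M}" and free: "free_on q (mat_ker q M) J" and r: "card J = r"
  obtain p where p: "p permutes {..<dim_col M}" "p ` {..<r} = J"
    using permutes_extending[OF J r] by blast
  have "\<exists>c\<in>mat_ker q M. \<forall>k\<in>J. c $ k = of_bool (k = p i) mod q" for i
    using free[unfolded free_on_def, rule_format, of "\<lambda>k. of_bool (k = p i)"] .
  then obtain v where v: "\<And>i. v i \<in> mat_ker q M" "\<And>i k. k \<in> J \<Longrightarrow> v i $ k = of_bool (k = p i) mod q"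
    by metis
  let ?n = "dim_col M"
  note rn = assms(2)
  define G where "G = mat r (?n - r) (\<lambda>(i, k). v i $ p (r + k))"
  have G: "G \<in> mats q r (?n - r)"
    unfolding mats_def
  proof (intro CollectI conjI allI impI)
    fix i k assume ik: "i < r" "k < ?n - r"
    then have "p (r + k) < ?n" using permutes_in_image[OF p(1), of "r + k"] by simp
    then show "G $$ (i, k) \<in> carrier (quot_ring q)"
      using ik mem_mat_ker_mod[OF v(1)] by (simp add: G_def)
  qed (simp add: G_def)
  have row: "sys_row r G i k = v i $ p k" if i: "i < r" and k: "k < ?n" for i k
  proof (cases "k < r")
    case True
    then have "p k \<in> J" using p(2) by blast
    \<comment> \<open>Here \<open>1 mod q = 1\<close> matters: the reduced unit entries of
      \<open>v i\<close> must be the literal 0 and 1 of the identity block.\<close>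
    then show ?thesis
      using True q permutes_inj[OF p(1)] by (auto simp: sys_row_def v(2) inj_eq)
  next
    case False
    then show ?thesis using i k by (simp add: sys_row_def G_def)
  qed
  have "q dvd (\<Sum>k<?n. M $$ (t, p k) * sys_row r G i k)" if i: "i < r" and t: "t < dim_row M" for i t
  proof -
    have "(\<Sum>k<?n. M $$ (t, p k) * sys_row r G i k) = (\<Sum>k<?n. M $$ (t, p k) * v i $ p k)"
      using row[OF i] by (intro sum.cong) auto
    also have "\<dots> = (\<Sum>k<?n. M $$ (t, k) * v i $ k)"
      by (subst sum.permute[OF p(1), of "\<lambda>k. M $$ (t, k) * v i $ k"]) (simp add: o_def)
    finally show ?thesis using v(1)[of i] t by (simp add: mat_ker_iff)
  qed
  then show "\<exists>p G. systematic_kernel q M r p G" using p(1) G by (auto simp: systematic_kernel_def)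
qed

text \<open>Conjugation is an involutive automorphism of R: a kernel vector of \<open>M\<close>
  taking the conjugated values on \<open>J\<close> is conjugated entrywise.\<close>

lemma free_on_conj:
  assumes l: "0 < l" and dim: "dim_row M' = dim_row M" "dim_col M' = dim_col M"
    and M': "\<And>i j. i < dim_row M \<Longrightarrow> j < dim_col M \<Longrightarrow> M' $$ (i, j) mod cyc l = conj_R l (M $$ (i, j)) mod cyc l"
    and J: "J \<subseteq> {..<dim_col M}" and free: "free_on (cyc l) (mat_ker (cyc l) M) J"
  shows "free_on (cyc l) (mat_ker (cyc l) M') J"
  unfolding free_on_def
proof
  fix f :: "nat \<Rightarrow> bit poly"
  obtain c where c: "c \<in> mat_ker (cyc l) M" "\<forall>j\<in>J. c $ j = conj_R l (f j) mod cyc l"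
    using free[unfolded free_on_def, rule_format, of "\<lambda>j. conj_R l (f j)"] by blast
  define w where "w = vec (dim_col M') (\<lambda>j. conj_R l (c $ j) mod cyc l)"
  have "w \<in> mat_ker (cyc l) M'"
    unfolding w_def vec_mod_mat_ker_iff unfolding dim
  proof (intro allI impI)
    fix i assume i: "i < dim_row M"
    have "conj_R l (\<Sum>j<dim_col M. M $$ (i, j) * c $ j) = 0"
      by (rule conj_R_dvd[OF l]) (use c(1) i in \<open>simp add: mat_ker_iff\<close>)
    then have "cyc l dvd (\<Sum>j<dim_col M. conj_R l (M $$ (i, j)) * conj_R l (c $ j))"
      unfolding conj_R_sum_mult by (rule mod_0_imp_dvd)
    moreover have "cyc l dvd (\<Sum>j<dim_col M. M' $$ (i, j) * conj_R l (c $ j)) \<longleftrightarrow>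
        cyc l dvd (\<Sum>j<dim_col M. conj_R l (M $$ (i, j)) * conj_R l (c $ j))"
      by (rule sum_mod_mult_dvd_iff, rule M'[OF i]) simp
    ultimately show "cyc l dvd (\<Sum>j<dim_col M. M' $$ (i, j) * conj_R l (c $ j))" by simp
  qed
  moreover have "w $ j = f j mod cyc l" if "j \<in> J" for j
    using that J c(2) by (auto simp: w_def dim conj_R_conj_R[OF l])
  ultimately show "\<exists>c\<in>mat_ker (cyc l) M'. \<forall>j\<in>J. c $ j = f j mod cyc l" by blast
qed

text \<open>Adjoint and transpose differ by entrywise conjugation, which is dealt with here over R,
  before passing to components.\<close>

lemma free_on_adj_mat_iff:
  assumes l: "0 < l" and J: "J \<subseteq> {..<dim_row B}"
  shows "free_on (cyc l) (mat_ker (cyc l) (adj_mat l B)) J \<longleftrightarrow>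
    free_on (cyc l) (mat_ker (cyc l) (transpose_mat B)) J"
proof
  assume "free_on (cyc l) (mat_ker (cyc l) (adj_mat l B)) J"
  then show "free_on (cyc l) (mat_ker (cyc l) (transpose_mat B)) J"
    using J by (intro free_on_conj[OF l _ _ _ _ \<open>free_on _ _ _\<close>]) (simp_all add: conj_R_conj_R[OF l])
next
  assume "free_on (cyc l) (mat_ker (cyc l) (transpose_mat B)) J"
  then show "free_on (cyc l) (mat_ker (cyc l) (adj_mat l B)) J"
    using J by (intro free_on_conj[OF l _ _ _ _ \<open>free_on _ _ _\<close>]) simp_all
qed

text \<open>Replaces the Kronecker row number j by the pair of its quotient and remainder modulo
  \<open>rB\<close>, the index set used for the dual families.\<close>

lemma shifted_rows_tensor:
  assumes dim: "dim_row M = rA * rB" "dim_col M = m * n + r"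
    and M: "\<And>j k. j < rA * rB \<Longrightarrow> k < m * n + r \<Longrightarrow> M $$ (j, k) =
      (if k < m * n then f (j div rB) (k div n) * g (j mod rB) (k mod n) else 0)"
  shows "shifted_rows l M = (\<lambda>x. reduce_vec (cyc l) (monom 1 (fst x) \<cdot>\<^sub>v
      tensor_vec (cyc l) m n r (f (fst (snd x))) (g (snd (snd x))))) ` ({..<l} \<times> {..<rA} \<times> {..<rB})"
    (is "_ = ?f ` _")
proof -
  have row: "reduce_vec (cyc l) (monom 1 e \<cdot>\<^sub>v row M j) = ?f (e, j div rB, j mod rB)"
    if j: "j < rA * rB" for e j
    by (rule eq_vecI) (auto simp: reduce_vec_def tensor_vec_def dim j M mod_mult_right_eq)
  show ?thesis
  proof (rule Set.set_eqI, rule iffI)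
    fix v assume "v \<in> shifted_rows l M"
    then obtain e j where e: "e < l" and j: "j < rA * rB" and v: "v = ?f (e, j div rB, j mod rB)"
      using row by (auto simp: shifted_rows_def dim)
    show "v \<in> ?f ` ({..<l} \<times> {..<rA} \<times> {..<rB})"
      unfolding v using e div_mod_less[OF j] by (intro imageI) simp
  next
    fix v assume "v \<in> ?f ` ({..<l} \<times> {..<rA} \<times> {..<rB})"
    then obtain e i j where eij: "e < l" "i < rA" "j < rB" and v: "v = ?f (e, i, j)" by auto
    have "i * rB + j < Suc i * rB" using eij(3) by simp
    also have "\<dots> \<le> rA * rB" using eij(2) by (intro mult_le_mono1) simp
    finally have less: "i * rB + j < rA * rB" .
    have "v = reduce_vec (cyc l) (monom 1 e \<cdot>\<^sub>v row M (i * rB + j))"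
      unfolding v row[OF less] using eij(3) by simp
    then show "v \<in> shifted_rows l M"
      using eij(1) less by (auto simp: shifted_rows_def dim)
  qed
qed

lemma LZ_rows_eq:
  assumes "mA < nA" "nB < mB" "GA \<in> mats q (nA - mA) mA"
  shows "LZ_rows l mA nA mB nB GA = (\<lambda>x. reduce_vec (cyc l) (monom 1 (fst x) \<cdot>\<^sub>v
      tensor_vec (cyc l) nA mB (mA * nB) (sys_row (nA - mA) GA (fst (snd x)))
        (\<lambda>s. of_bool (s = snd (snd x))))) ` ({..<l} \<times> {..<nA - mA} \<times> {..<mB - nB})"
proof -
  have GA: "dim_row GA = nA - mA" "dim_col GA = mA" using assms(3) by (auto simp: mats_def)
  have "nA - mA + mA = nA" "mB - nB + nB = mB" using assms(1,2) by auto
  note dims = GA this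
  show ?thesis
    unfolding LZ_rows_def Let_def
  proof (rule shifted_rows_tensor)
    fix j k assume j: "j < (nA - mA) * (mB - nB)" and k: "k < nA * mB + mA * nB"
    \<comment> \<open>This is the column inside the zero block: \<open>k mod mB\<close> minus the
      width \<open>mB - nB\<close> of the identity block.\<close>
    have idx: "k mod mB + nB - mB < nB" if "\<not> k mod mB < mB - nB" "k < nA * mB"
      using div_mod_less(2)[OF that(2)] that(1) assms(2) by linarith
    show "append_cols (kron (append_cols (1\<^sub>m (nA - mA)) GA)
          (append_cols (1\<^sub>m (mB - nB)) (0\<^sub>m (mB - nB) nB)))
        (0\<^sub>m ((nA - mA) * (mB - nB)) (mA * nB)) $$ (j, k) =
      (if k < nA * mB then sys_row (nA - mA) GA (j div (mB - nB)) (k div mB) *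
        of_bool (k mod mB = j mod (mB - nB)) else 0)"
      using j k div_mod_less[OF j] div_mod_less[of k nA mB]
      by (auto simp: append_cols_def kron_def dims sys_row_def idx)
  qed (simp_all add: append_cols_def kron_def dims)
qed

lemma LX_rows_eq:
  assumes "mA < nA" "nB < mB" "GB \<in> mats q (mB - nB) nB"
  shows "LX_rows l mA nA mB nB GB = (\<lambda>x. reduce_vec (cyc l) (monom 1 (fst x) \<cdot>\<^sub>v
      tensor_vec (cyc l) nA mB (mA * nB) (\<lambda>p. of_bool (p = fst (snd x)))
        (sys_row (mB - nB) GB (snd (snd x))))) ` ({..<l} \<times> {..<nA - mA} \<times> {..<mB - nB})"
proof -
  have GB: "dim_row GB = mB - nB" "dim_col GB = nB" using assms(3) by (auto simp: mats_def)
  have "nA - mA + mA = nA" "mB - nB + nB = mB" using assms(1,2) by auto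
  note dims = GB this
  show ?thesis
    unfolding LX_rows_def Let_def
  proof (rule shifted_rows_tensor)
    fix j k assume j: "j < (nA - mA) * (mB - nB)" and k: "k < nA * mB + mA * nB"
    have idx: "k div mB + mA - nA < mA" if "\<not> k div mB < nA - mA" "k < nA * mB"
      using div_mod_less(1)[OF that(2)] that(1) assms(1) by linarith
    show "append_cols (kron (append_cols (1\<^sub>m (nA - mA)) (0\<^sub>m (nA - mA) mA))
          (append_cols (1\<^sub>m (mB - nB)) GB))
        (0\<^sub>m ((nA - mA) * (mB - nB)) (mA * nB)) $$ (j, k) =
      (if k < nA * mB then of_bool (k div mB = j div (mB - nB)) *
        sys_row (mB - nB) GB (j mod (mB - nB)) (k mod mB) else 0)"
      using j k div_mod_less[OF j] div_mod_less[of k nA mB]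
      by (auto simp: append_cols_def kron_def dims sys_row_def idx)
  qed (simp_all add: append_cols_def kron_def dims)
qed

lemma reduce_tensor_vec: "reduce_vec q (tensor_vec q m n r a b) = tensor_vec q m n r a b"
  by (rule eq_vecI) (simp_all add: reduce_vec_def tensor_vec_def)

lemma dim_permute [simp]:
  "dim_row (permute_cols p A) = dim_row A" "dim_col (permute_cols p A) = dim_col A"
  "dim_row (permute_rows s B) = dim_row B" "dim_col (permute_rows s B) = dim_col B"
  by (simp_all add: permute_cols_def permute_rows_def)

lemma sum_permute_cols:
  "t < dim_row A \<Longrightarrow> (\<Sum>k<dim_col A. permute_cols p A $$ (t, k) * f k) = (\<Sum>k<dim_col A. A $$ (t, p k) * f k)"
  by (intro sum.cong) (auto simp: permute_cols_def)

lemma sum_adj_permute_rows: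
  assumes "s permutes {..<dim_row B}" "c < dim_col B"
  shows "(\<Sum>k<dim_row B. adj_mat l (permute_rows s B) $$ (c, k) * f k) =
    (\<Sum>k<dim_row B. adj_mat l B $$ (c, s k) * f k)"
  using assms permutes_in_image[OF assms(1)] by (intro sum.cong) (auto simp: permute_rows_def)

lemma dual_tensor_rows_permuted:
  assumes l: "0 < l" and rA: "rA \<le> dim_col A" and rB: "rB \<le> dim_row B"
    and A: "systematic_kernel (cyc l) A rA p GA" and B: "systematic_kernel (cyc l) (adj_mat l B) rB s GB"
  shows "dual_tensor_rows l (permute_cols p A) (permute_rows s B) rA rB (sys_row rA GA) (sys_row rB GB)
    (\<lambda>i. i) (\<lambda>j. j)"
proof (unfold_locales, unfold dim_permute)
  show "cyc l dvd (\<Sum>k<dim_col A. permute_cols p A $$ (t, k) * sys_row rA GA i k)"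
    if "i < rA" "t < dim_row A" for i t
    using A that by (simp add: sum_permute_cols systematic_kernel_def)
  show "cyc l dvd (\<Sum>k<dim_row B. adj_mat l (permute_rows s B) $$ (c, k) * sys_row rB GB j k)"
    if "j < rB" "c < dim_col B" for j c
  proof -
    have "s permutes {..<dim_row B}" using B by (simp add: systematic_kernel_def)
    from sum_adj_permute_rows[OF this that(2)] show ?thesis
      using B that by (simp only:) (simp add: systematic_kernel_def)
  qed
qed (use l rA rB in \<open>auto simp: sys_row_def\<close>)

text \<open>The same families on the original matrices, with unit positions \<open>p\<close> and
  \<open>s\<close>. This bounds the number of logical qubits of \<open>A\<close>, \<open>B\<close>
  directly, without comparing the homology of permuted and original complexes.\<close>

lemma dual_tensor_rows_original:
  assumes l: "0 < l" and rA: "rA \<le> dim_col A" and rB: "rB \<le> dim_row B"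
    and A: "systematic_kernel (cyc l) A rA p GA" and B: "systematic_kernel (cyc l) (adj_mat l B) rB s GB"
  shows "dual_tensor_rows l A B rA rB (\<lambda>i k. sys_row rA GA i (inv_into UNIV p k)) (\<lambda>j k. sys_row rB GB j (inv_into UNIV s k)) p s"
proof -
  have p: "p permutes {..<dim_col A}" and s: "s permutes {..<dim_row B}"
    using A B by (simp_all add: systematic_kernel_def)
  show ?thesis
  proof unfold_locales
    show "cyc l dvd (\<Sum>k<dim_col A. A $$ (t, k) * sys_row rA GA i (inv_into UNIV p k))"
      if "i < rA" "t < dim_row A" for i t
      using A that by (subst sum.permute[OF p])
        (simp add: o_def permutes_inverses(2)[OF p] systematic_kernel_def)
    show "cyc l dvd (\<Sum>k<dim_row B. adj_mat l B $$ (c, k) * sys_row rB GB j (inv_into UNIV s k))"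
      if "j < rB" "c < dim_col B" for j c
      using B that by (subst sum.permute[OF s])
        (simp add: o_def permutes_inverses(2)[OF s] systematic_kernel_def)
    show "p i < dim_col A" if "i < rA" for i using permutes_in_image[OF p, of i] that rA by simp
    show "s j < dim_row B" if "j < rB" for j using permutes_in_image[OF s, of j] that rB by simp
  qed (use l in \<open>simp_all add: sys_row_def permutes_inverses(2)[OF p] permutes_inverses(2)[OF s]\<close>)
qed

lemma dual_tensor_rows_rows:
  assumes "0 < l" "dim_row A < dim_col A" "dim_col B < dim_row B"
    and "systematic_kernel (cyc l) A (dim_col A - dim_row A) p GA"
    and "systematic_kernel (cyc l) (adj_mat l B) (dim_row B - dim_col B) s GB"
  shows "dual_tensor_rows.Z_rows l (permute_cols p A) (permute_rows s B) (dim_col A - dim_row A)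
      (dim_row B - dim_col B) (sys_row (dim_col A - dim_row A) GA) (\<lambda>j. j) =
      LZ_rows l (dim_row A) (dim_col A) (dim_row B) (dim_col B) GA" (is ?Z)
    and "dual_tensor_rows.X_rows l (permute_cols p A) (permute_rows s B) (dim_col A - dim_row A)
      (dim_row B - dim_col B) (sys_row (dim_row B - dim_col B) GB) (\<lambda>i. i) =
      LX_rows l (dim_row A) (dim_col A) (dim_row B) (dim_col B) GB" (is ?X)
proof -
  interpret D: dual_tensor_rows l "permute_cols p A" "permute_rows s B" "dim_col A - dim_row A"
    "dim_row B - dim_col B" "sys_row (dim_col A - dim_row A) GA" "sys_row (dim_row B - dim_col B) GB"
    "\<lambda>i. i" "\<lambda>j. j"
    using assms by (intro dual_tensor_rows_permuted) simp_all
  have GA: "GA \<in> mats (cyc l) (dim_col A - dim_row A) (dim_row A)"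
    and GB: "GB \<in> mats (cyc l) (dim_row B - dim_col B) (dim_col B)"
    using assms by (simp_all add: systematic_kernel_def)
  show ?Z
    unfolding D.Z_rows_def LZ_rows_eq[OF assms(2,3) GA] dim_permute ..
  show ?X
    unfolding D.X_rows_def LX_rows_eq[OF assms(2,3) GB] dim_permute ..
qed

text \<open>Membership of the rows in cycles and cocycles already forces the systematic form: a
  boundary of a pure tensor with a unit vector as one factor exposes the kernel equation of the
  other.\<close>

lemma canonical_LP_basis_imp_systematic_kernel:
  assumes l: "0 < l" and dA: "dim_row A < dim_col A" and dB: "dim_col B < dim_row B"
    and can: "canonical_LP_basis l A B p s GA GB SZ SX"
  shows "systematic_kernel (cyc l) A (dim_col A - dim_row A) p GA"
    and "systematic_kernel (cyc l) (adj_mat l B) (dim_row B - dim_col B) s GB"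
proof -
  let ?mA = "dim_row A" and ?nA = "dim_col A" and ?mB = "dim_row B" and ?nB = "dim_col B"
  let ?A = "permute_cols p A" and ?B = "permute_rows s B" and ?q = "cyc l"
  have p: "p permutes {..<?nA}" and s: "s permutes {..<?mB}"
    and GA: "GA \<in> mats ?q (?nA - ?mA) ?mA" and GB: "GB \<in> mats ?q (?mB - ?nB) ?nB"
    and Z: "LZ_rows l ?mA ?nA ?mB ?nB GA \<subseteq> mat_ker ?q (bd1 ?A ?B)"
    and X: "LX_rows l ?mA ?nA ?mB ?nB GB \<subseteq> mat_ker ?q (adj_mat l (bd2 ?A ?B))"
    using can unfolding canonical_LP_basis_def Let_def Z_basis_def X_basis_def represents_basis_def
    by blast+
  have "?q dvd (\<Sum>k<?nA. A $$ (t, p k) * sys_row (?nA - ?mA) GA i k)"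
    if i: "i < ?nA - ?mA" and t: "t < ?mA" for i t
  proof -
    \<comment> \<open>The unshifted row with second factor the unit vector at 0; it exists because
      \<open>dim_col B < dim_row B\<close>, and coordinate 0 of that factor gives the equation for
      \<open>A\<close>.\<close>
    have "tensor_vec ?q ?nA ?mB (?mA * ?nB) (sys_row (?nA - ?mA) GA i) (\<lambda>s. of_bool (s = 0)) \<in>
        LZ_rows l ?mA ?nA ?mB ?nB GA"
      unfolding LZ_rows_eq[OF dA dB GA]
      by (rule image_eqI[of _ _ "(0, i, 0)"]) (use l dB i in \<open>simp_all add: reduce_tensor_vec\<close>)
    from subsetD[OF Z this]
    have "\<forall>t<?mA. \<forall>s<?mB. ?q dvd (\<Sum>k<?nA. ?A $$ (t, k) * sys_row (?nA - ?mA) GA i k) * of_bool (s = 0)"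
      unfolding tensor_vec_mat_ker_bd1[of ?q ?A ?B, unfolded dim_permute] .
    from this[rule_format, of t 0] show ?thesis using t dB by (simp add: sum_permute_cols[OF t])
  qed
  then show "systematic_kernel ?q A (?nA - ?mA) p GA"
    using p GA dA by (simp add: systematic_kernel_def)
  have "?q dvd (\<Sum>k<?mB. adj_mat l B $$ (c, s k) * sys_row (?mB - ?nB) GB j k)"
    if j: "j < ?mB - ?nB" and c: "c < ?nB" for j c
  proof -
    \<comment> \<open>Symmetrically, the first factor is the unit vector at 0, available because
      \<open>dim_row A < dim_col A\<close>.\<close>
    have "tensor_vec ?q ?nA ?mB (?mA * ?nB) (\<lambda>p. of_bool (p = 0)) (sys_row (?mB - ?nB) GB j) \<in>
        LX_rows l ?mA ?nA ?mB ?nB GB"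
      unfolding LX_rows_eq[OF dA dB GB]
      by (rule image_eqI[of _ _ "(0, 0, j)"]) (use l dA j in \<open>simp_all add: reduce_tensor_vec\<close>)
    from subsetD[OF X this]
    have "\<forall>p<?nA. \<forall>c<?nB. ?q dvd of_bool (p = 0) *
        (\<Sum>k<?mB. adj_mat l ?B $$ (c, k) * sys_row (?mB - ?nB) GB j k)"
      unfolding tensor_vec_mat_ker_adj_bd2[of ?q ?A ?B, unfolded dim_permute] .
    from this[rule_format, of 0 c] show ?thesis
      using c dA unfolding sum_adj_permute_rows[OF s c] by simp
  qed
  then show "systematic_kernel ?q (adj_mat l B) (?mB - ?nB) s GB"
    using s GB dB by (simp add: systematic_kernel_def)
qed

lemma systematic_kernel_imp_canonical_LP_basis:
  assumes l: "0 < l" and dA: "dim_row A < dim_col A" and dB: "dim_col B < dim_row B"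
    and A: "systematic_kernel (cyc l) A (dim_col A - dim_row A) p GA"
    and B: "systematic_kernel (cyc l) (adj_mat l B) (dim_row B - dim_col B) s GB"
  shows "\<exists>SZ SX. canonical_LP_basis l A B p s GA GB SZ SX"
proof -
  interpret D: dual_tensor_rows l "permute_cols p A" "permute_rows s B" "dim_col A - dim_row A"
    "dim_row B - dim_col B" "sys_row (dim_col A - dim_row A) GA" "sys_row (dim_row B - dim_col B) GB"
    "\<lambda>i. i" "\<lambda>j. j"
    using assms by (intro dual_tensor_rows_permuted) simp_all
  obtain SZ SX where S: "Z_basis l (permute_cols p A) (permute_rows s B) SZ" "D.Z_rows \<subseteq> SZ"
    "X_basis l (permute_cols p A) (permute_rows s B) SX" "D.X_rows \<subseteq> SX"
    using D.ex_Z_basis D.ex_X_basis by blast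
  have "p permutes {..<dim_col A}" "s permutes {..<dim_row B}"
    "GA \<in> mats (cyc l) (dim_col A - dim_row A) (dim_row A)"
    "GB \<in> mats (cyc l) (dim_row B - dim_col B) (dim_col B)"
    using A B dA dB by (simp_all add: systematic_kernel_def)
  then show ?thesis
    using S unfolding dual_tensor_rows_rows[OF assms] canonical_LP_basis_def Let_def by blast
qed

lemma canonical_sector:
  assumes l: "0 < l" and dA: "dim_row A < dim_col A" and dB: "dim_col B < dim_row B"
    and A: "systematic_kernel (cyc l) A (dim_col A - dim_row A) p GA"
    and B: "systematic_kernel (cyc l) (adj_mat l B) (dim_row B - dim_col B) s GB"
  shows "card (Z_class l (permute_cols p A) (permute_rows s B) `
        LZ_rows l (dim_row A) (dim_col A) (dim_row B) (dim_col B) GA) =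
      (dim_col A - dim_row A) * (dim_row B - dim_col B) * l" (is ?Z)
    and "card (X_class l (permute_cols p A) (permute_rows s B) `
        LX_rows l (dim_row A) (dim_col A) (dim_row B) (dim_col B) GB) =
      (dim_col A - dim_row A) * (dim_row B - dim_col B) * l" (is ?X)
    and "(dim_col A - dim_row A) * (dim_row B - dim_col B) * l \<le> num_logical l A B" (is ?k)
proof -
  interpret D: dual_tensor_rows l "permute_cols p A" "permute_rows s B" "dim_col A - dim_row A"
    "dim_row B - dim_col B" "sys_row (dim_col A - dim_row A) GA" "sys_row (dim_row B - dim_col B) GB"
    "\<lambda>i. i" "\<lambda>j. j"
    using assms by (intro dual_tensor_rows_permuted) simp_all
  show ?Z ?X
    using D.card_Z_class D.card_X_class unfolding dual_tensor_rows_rows[OF assms] by blast+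
  \<comment> \<open>The bound concerns the original \<open>A\<close> and \<open>B\<close>, hence the
    other instance of the locale.\<close>
  show ?k
    by (rule dual_tensor_rows.le_num_logical[OF dual_tensor_rows_original[OF l _ _ A B]]) simp_all
qed

theorem theorem13:
  fixes l mA nA mB nB t :: nat
    and A B :: "bit poly mat"
    and b \<beta> :: "nat \<Rightarrow> bit poly"
  assumes "odd l"
    and "A \<in> mats (cyc l) mA nA" and "B \<in> mats (cyc l) mB nB"
    and "mA < nA" and "nB < mB"
    and "cyc l = (\<Prod>i=1..t. b i)"
    and "\<And>i. i \<in> {1..t} \<Longrightarrow> irreducible (b i)"
    and "\<And>i. i \<in> {1..t} \<Longrightarrow> \<beta> i \<in> carrier (quot_ring (b i))"
    and "\<And>i. i \<in> {1..t} \<Longrightarrow> eval_quot (b i) (\<beta> i) (b i) = 0"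
  shows "(admits_canonical_LP_basis l A B \<longleftrightarrow>
      (\<exists>IA IB.
        (\<forall>i\<in>{1..t}. information_set (b i) nA (mat_ker (b i) (component (b i) (\<beta> i) A)) (IA i)) \<and>
        (\<forall>i\<in>{1..t}. information_set (b i) mB
            (mat_ker (b i) (transpose_mat (component (b i) (\<beta> i) B))) (IB i)) \<and>
        card (\<Inter>i\<in>{1..t}. IA i) \<ge> nA - mA \<and> card (\<Inter>i\<in>{1..t}. IB i) \<ge> mB - nB))
    \<and> (\<forall>p s GA GB SZ SX. canonical_LP_basis l A B p s GA GB SZ SX \<longrightarrow>
        (let A' = permute_cols p A; B' = permute_rows s B;
             k\<^sub>c = (nA - mA) * (mB - nB) * l in
          card (Z_class l A' B' ` LZ_rows l mA nA mB nB GA) = k\<^sub>c \<and>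
          card (X_class l A' B' ` LX_rows l mA nA mB nB GB) = k\<^sub>c \<and>
          k\<^sub>c \<le> num_logical l A B))"
proof (rule conjI)
  have l: "0 < l" using assms(1) by (auto elim: oddE)
  have dims: "dim_row A = mA" "dim_col A = nA" "dim_row B = mB" "dim_col B = nB"
    using assms(2,3) by (auto simp: mats_def)
  have dA: "dim_row A < dim_col A" and dB: "dim_col B < dim_row B"
    using assms(4,5) by (simp_all add: dims)
  note sys = canonical_LP_basis_imp_systematic_kernel[OF l dA dB]
  let ?comp = "\<lambda>C i. component (b i) (\<beta> i) C"
  let ?info = "\<lambda>M r. \<exists>I. (\<forall>i\<in>{1..t}. information_set (b i) (dim_col M) (mat_ker (b i) (?comp M i)) (I i)) \<and>
    r \<le> card (\<Inter>i\<in>{1..t}. I i)"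
  have info: "?info M r \<longleftrightarrow> (\<exists>J\<subseteq>{..<dim_col M}. card J = r \<and> free_on (cyc l) (mat_ker (cyc l) M) J)"
    for M r by (rule information_sets_iff_free_on_cyc) (use assms in auto)
  have A: "(\<exists>p GA. systematic_kernel (cyc l) A (nA - mA) p GA) \<longleftrightarrow> ?info A (nA - mA)"
    unfolding info by (rule systematic_kernel_iff_free_on) (simp_all add: one_mod_cyc[OF l] dims)
  have "(\<exists>s GB. systematic_kernel (cyc l) (adj_mat l B) (mB - nB) s GB) \<longleftrightarrow>
      (\<exists>J\<subseteq>{..<dim_col (adj_mat l B)}. card J = mB - nB \<and> free_on (cyc l) (mat_ker (cyc l) (adj_mat l B)) J)"
    by (rule systematic_kernel_iff_free_on) (simp_all add: one_mod_cyc[OF l] dims)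
  \<comment> \<open>The free sets pass from the adjoint to the transpose of \<open>B\<close> while
    the modulus is still \<open>cyc l\<close>; only then are they split into components.\<close>
  also have "\<dots> \<longleftrightarrow> ?info (transpose_mat B) (mB - nB)"
    unfolding info using free_on_adj_mat_iff[OF l, of _ B] by auto
  finally have B: "(\<exists>s GB. systematic_kernel (cyc l) (adj_mat l B) (mB - nB) s GB) \<longleftrightarrow>
      ?info (transpose_mat B) (mB - nB)" .
  have transpose: "?comp (transpose_mat B) i = transpose_mat (?comp B i)" for i
    by (auto simp: component_def)
  have "admits_canonical_LP_basis l A B \<longleftrightarrow>
      (\<exists>p GA. systematic_kernel (cyc l) A (nA - mA) p GA) \<and>
      (\<exists>s GB. systematic_kernel (cyc l) (adj_mat l B) (mB - nB) s GB)"
  proof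
    assume "admits_canonical_LP_basis l A B"
    then obtain p s GA GB SZ SX where "canonical_LP_basis l A B p s GA GB SZ SX"
      unfolding admits_canonical_LP_basis_def by (elim exE)
    from sys[OF this] show "(\<exists>p GA. systematic_kernel (cyc l) A (nA - mA) p GA) \<and>
        (\<exists>s GB. systematic_kernel (cyc l) (adj_mat l B) (mB - nB) s GB)"
      unfolding dims by blast
  next
    assume "(\<exists>p GA. systematic_kernel (cyc l) A (nA - mA) p GA) \<and>
        (\<exists>s GB. systematic_kernel (cyc l) (adj_mat l B) (mB - nB) s GB)"
    then obtain p GA s GB where "systematic_kernel (cyc l) A (nA - mA) p GA"
      "systematic_kernel (cyc l) (adj_mat l B) (mB - nB) s GB" by (elim exE conjE)
    from systematic_kernel_imp_canonical_LP_basis[OF l dA dB, unfolded dims, OF this]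
    show "admits_canonical_LP_basis l A B" unfolding admits_canonical_LP_basis_def by blast
  qed
  also have "\<dots> \<longleftrightarrow> ?info A (nA - mA) \<and> ?info (transpose_mat B) (mB - nB)"
    unfolding A B ..
  finally show "admits_canonical_LP_basis l A B \<longleftrightarrow>
      (\<exists>IA IB.
        (\<forall>i\<in>{1..t}. information_set (b i) nA (mat_ker (b i) (component (b i) (\<beta> i) A)) (IA i)) \<and>
        (\<forall>i\<in>{1..t}. information_set (b i) mB
            (mat_ker (b i) (transpose_mat (component (b i) (\<beta> i) B))) (IB i)) \<and>
        card (\<Inter>i\<in>{1..t}. IA i) \<ge> nA - mA \<and> card (\<Inter>i\<in>{1..t}. IB i) \<ge> mB - nB)"
    unfolding transpose index_transpose_mat dims by blast
  show "\<forall>p s GA GB SZ SX. canonical_LP_basis l A B p s GA GB SZ SX \<longrightarrow>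
        (let A' = permute_cols p A; B' = permute_rows s B;
             k\<^sub>c = (nA - mA) * (mB - nB) * l in
          card (Z_class l A' B' ` LZ_rows l mA nA mB nB GA) = k\<^sub>c \<and>
          card (X_class l A' B' ` LX_rows l mA nA mB nB GB) = k\<^sub>c \<and>
          k\<^sub>c \<le> num_logical l A B)"
    unfolding Let_def
  proof (intro allI impI)
    fix p s GA GB SZ SX assume "canonical_LP_basis l A B p s GA GB SZ SX"
    note canonical_sector[OF l dA dB sys[OF this]]
    then show "card (Z_class l (permute_cols p A) (permute_rows s B) ` LZ_rows l mA nA mB nB GA) =
          (nA - mA) * (mB - nB) * l \<and>
        card (X_class l (permute_cols p A) (permute_rows s B) ` LX_rows l mA nA mB nB GB) =
          (nA - mA) * (mB - nB) * l \<and>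
        (nA - mA) * (mB - nB) * l \<le> num_logical l A B"
      unfolding dims by blast
  qed
qed

end
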